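(* Let $M$ be a $C^\infty$ real hypersurface in $\mathbb{C}^n$ and $p\in M$. If there exists an $\mathcal{N}$-canonical coordinate $(z)$ for $M$ at $p$, then the following five conditions are equivalent: (1) $\Delta_1(M,p)=\infty$; (2) $\Delta_1^{\rm reg}(M,p)=\infty$; (3) there exists $\gamma\in\Gamma^{\rm reg}$ tangent to $M$ at $p$ to infinite order; (4) there exists $\gamma\in\Gamma$ tangent to $M$ at $p$ to infinite order; (5) there exists a holomorphic coordinate $(z)$ at $p$ with $p=0$ such that a local defining function for $M$ in $(z)$ is not convenient.
   Context: A local defining function $r$ for $M$ near $p$ is a real-valued $C^\infty$ function with $M=\{r=0\}$ near $p$ and $\nabla r\neq0$ on $M$. $\operatorname{ord}(h)$ denotes the order of vanishing at $0$. $\Gamma$ is the set of germs of nonconstant holomorphic maps $\gamma:(\mathbb{C},0)\to(\mathbb{C}^n,p)$ (with good parametrization: each image point corresponds to one $t$). $\Delta_1(M,p)=\sup_{\gamma\in\Gamma}\operatorname{ord}(r\circ\gamma)/\operatorname{ord}(\gamma-p)$; $\Gamma^{\rm reg}=\{\gamma\in\Gamma:\operatorname{ord}(\gamma-p)=1\}$; $\Delta_1^{\rm reg}(M,p)=\sup_{\gamma\in\Gamma^{\rm reg}}\operatorname{ord}(r\circ\gamma)$. $\gamma$ is tangent to $M$ at $p$ to infinite order if $(r\circ\gamma)(t)=O(t^N)$ for all $N$. Newton polyhedron: for real-valued smooth $F$ near $0\in\mathbb{C}^n$ with Taylor series $\sum C_{\alpha\beta}z^\alpha\bar z^\beta$,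 $S(F)=\{\alpha+\beta:C_{\alpha\beta}\ne0\}$, $\mathcal{N}_+(F)=$ convex hull of $\bigcup_{\alpha+\beta\in S(F)}(\alpha+\beta+\mathbb{R}_+^n)$. $F$ is convenient if $\mathcal{N}_+(F)$ meets every coordinate axis. For a compact face $\kappa$ of $\mathcal{N}_+(F)$, the $\kappa$-part is $F_\kappa=\sum_{\alpha+\beta\in\kappa}C_{\alpha\beta}z^\alpha\bar z^\beta$, and $\Gamma_\kappa$ is the set of curves $t\mapsto(c_1t^{a_1},\dots,c_nt^{a_n})$ with $c\in(\mathbb{C}\setminus\{0\})^n$ and $a\in\mathbb{N}^n$ such that $\{\xi\in\mathcal{N}_+(F):\sum a_j\xi_j=l\}=\kappa$ for some $l\in\mathbb{N}$. $F_\kappa$ is $\mathcal{N}$-nondegenerate if $F_\kappa\circ\gamma\not\equiv0$ for all $\gamma\in\Gamma_\kappa$; $F$ is $\mathcal{N}$-nondegenerate if $F_\kappa$ is for every compact face $\kappa$. A holomorphic coordinate $(z)$ at $p$ (with $p=0$) is $\mathcal{N}$-canonical for $M$ at $p$ if a local defining function for $M$ in the coordinate $(z)$ is $\mathcal{N}$-nondegenerate. *)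

theory Defs
  imports "HOL-Analysis.Analysis" "HOL-Library.Landau_Symbols" "HOL-Library.Extended_Real"
begin

definition dderiv :: "'a::real_normed_vector \<Rightarrow> ('a \<Rightarrow> real) \<Rightarrow> 'a \<Rightarrow> real" where
  "dderiv v f x = deriv (\<lambda>t::real. f (x + t *\<^sub>R v)) 0"

fun dderivs :: "'a::real_normed_vector list \<Rightarrow> ('a \<Rightarrow> real) \<Rightarrow> 'a \<Rightarrow> real" where
  "dderivs [] f = f"
| "dderivs (v # vs) f = dderiv v (dderivs vs f)"

definition smooth_on :: "'a::euclidean_space set \<Rightarrow> ('a \<Rightarrow> real) \<Rightarrow> bool" where
  "smooth_on U f \<longleftrightarrow> (\<forall>vs. set vs \<subseteq> Basis \<longrightarrow> dderivs vs f differentiable_on U)"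

definition local_defining_fun :: "(complex^'n) set \<Rightarrow> complex^'n \<Rightarrow> (complex^'n \<Rightarrow> real) \<Rightarrow> bool" where
  "local_defining_fun M p r \<longleftrightarrow>
     (\<exists>W. open W \<and> p \<in> W \<and> smooth_on W r \<and> M \<inter> W = {z \<in> W. r z = 0} \<and>
          (\<forall>z \<in> M \<inter> W. frechet_derivative r (at z) \<noteq> (\<lambda>v. 0)))"

definition real_hypersurface :: "(complex^'n) set \<Rightarrow> bool" where
  "real_hypersurface M \<longleftrightarrow> (\<forall>q \<in> M. \<exists>r. local_defining_fun M q r)"

definition holo_map_on :: "(complex^'n) set \<Rightarrow> (complex^'n \<Rightarrow> complex^'m) \<Rightarrow> bool" where
  "holo_map_on U \<Phi> \<longleftrightarrow> (\<forall>z \<in> U. \<exists>L. (\<Phi> has_derivative L) (at z) \<and>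
                         (\<forall>(c::complex) w. L (c *s w) = c *s L w))"

definition hol_coord :: "complex^'n \<Rightarrow> (complex^'n) set \<Rightarrow> (complex^'n \<Rightarrow> complex^'n) \<Rightarrow> bool" where
  "hol_coord p U \<Phi> \<longleftrightarrow> open U \<and> p \<in> U \<and> open (\<Phi> ` U) \<and> \<Phi> p = 0 \<and> holo_map_on U \<Phi> \<and>
     (\<exists>\<Psi>. holo_map_on (\<Phi> ` U) \<Psi> \<and> (\<forall>z \<in> U. \<Psi> (\<Phi> z) = z))"

definition vanish_ord :: "(complex \<Rightarrow> 'a::real_normed_vector) \<Rightarrow> enat" where
  "vanish_ord h = Sup {enat k | k. (\<lambda>t. norm (h t)) \<in> O[at 0](\<lambda>t. norm t ^ k)}"

definition Gamma :: "complex^'n \<Rightarrow> (complex \<Rightarrow> complex^'n) set" where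
  "Gamma p = {\<gamma>. \<exists>\<epsilon>>0. (\<forall>j. (\<lambda>t. \<gamma> t $ j) holomorphic_on ball 0 \<epsilon>) \<and> \<gamma> 0 = p \<and>
                      (\<exists>t \<in> ball 0 \<epsilon>. \<gamma> t \<noteq> p) \<and> inj_on \<gamma> (ball 0 \<epsilon>)}"

definition Gamma_reg :: "complex^'n \<Rightarrow> (complex \<Rightarrow> complex^'n) set" where
  "Gamma_reg p = {\<gamma> \<in> Gamma p. vanish_ord (\<lambda>t. \<gamma> t - p) = 1}"

definition Delta1 :: "(complex^'n \<Rightarrow> real) \<Rightarrow> complex^'n \<Rightarrow> ereal" where
  "Delta1 r p = (SUP \<gamma> \<in> Gamma p.
      ereal_of_enat (vanish_ord (r \<circ> \<gamma>)) / ereal_of_enat (vanish_ord (\<lambda>t. \<gamma> t - p)))"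

definition Delta1_reg :: "(complex^'n \<Rightarrow> real) \<Rightarrow> complex^'n \<Rightarrow> enat" where
  "Delta1_reg r p = (SUP \<gamma> \<in> Gamma_reg p. vanish_ord (r \<circ> \<gamma>))"

definition inf_tangent :: "(complex^'n \<Rightarrow> real) \<Rightarrow> (complex \<Rightarrow> complex^'n) \<Rightarrow> bool" where
  "inf_tangent r \<gamma> \<longleftrightarrow> (\<forall>N::nat. (\<lambda>t. r (\<gamma> t)) \<in> O[at 0](\<lambda>t. norm t ^ N))"

definition enum_idx :: "'n::finite list" where
  "enum_idx = (SOME xs. set xs = UNIV \<and> distinct xs)"

definition idx_list :: "('n::finite \<Rightarrow> nat) \<Rightarrow> (real^'n) list" where
  "idx_list m = concat (map (\<lambda>j. replicate (m j) (axis j 1)) enum_idx)"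

text \<open>The part of the Taylor series of F at 0 of multidegree m, i.e.
  sum over alpha+beta=m of C_{alpha beta} z^alpha conj(z)^beta, obtained as the
  coefficient of s^m in the Taylor expansion of s \<mapsto> F(s_1 z_1,...,s_n z_n), s real.\<close>
definition taylor_part :: "(complex^'n::finite \<Rightarrow> real) \<Rightarrow> ('n \<Rightarrow> nat) \<Rightarrow> complex^'n \<Rightarrow> real" where
  "taylor_part F m z =
     dderivs (idx_list m) (\<lambda>s::real^'n. F (\<chi> j. complex_of_real (s $ j) * z $ j)) 0
       / (\<Prod>j\<in>UNIV. fact (m j))"

definition supp_S :: "(complex^'n::finite \<Rightarrow> real) \<Rightarrow> ('n \<Rightarrow> nat) set" where
  "supp_S F = {m. \<exists>z. taylor_part F m z \<noteq> 0}"

definition mvec :: "('n::finite \<Rightarrow> nat) \<Rightarrow> real^'n" where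
  "mvec m = (\<chi> j. real (m j))"

definition newton_poly :: "(complex^'n::finite \<Rightarrow> real) \<Rightarrow> (real^'n) set" where
  "newton_poly F = convex hull (\<Union>m \<in> supp_S F. {\<xi>. \<forall>j. real (m j) \<le> \<xi> $ j})"

definition convenient :: "(complex^'n::finite \<Rightarrow> real) \<Rightarrow> bool" where
  "convenient F \<longleftrightarrow> (\<forall>j. \<exists>\<xi> \<in> newton_poly F. \<forall>i. i \<noteq> j \<longrightarrow> \<xi> $ i = 0)"

definition compact_face :: "(complex^'n::finite \<Rightarrow> real) \<Rightarrow> (real^'n) set \<Rightarrow> bool" where
  "compact_face F \<kappa> \<longleftrightarrow> \<kappa> face_of newton_poly F \<and> compact \<kappa> \<and> \<kappa> \<noteq> {}"

definition kappa_part :: "(complex^'n::finite \<Rightarrow> real) \<Rightarrow> (real^'n) set \<Rightarrow> complex^'n \<Rightarrow> real" where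
  "kappa_part F \<kappa> z = (\<Sum>m \<in> {m \<in> supp_S F. mvec m \<in> \<kappa>}. taylor_part F m z)"

definition Gamma_kappa :: "(complex^'n::finite \<Rightarrow> real) \<Rightarrow> (real^'n) set \<Rightarrow> (complex \<Rightarrow> complex^'n) set" where
  "Gamma_kappa F \<kappa> = {\<gamma>. \<exists>(c::complex^'n) (a::'n \<Rightarrow> nat) (l::nat). (\<forall>j. c $ j \<noteq> 0) \<and>
       {\<xi> \<in> newton_poly F. (\<Sum>j\<in>UNIV. real (a j) * \<xi> $ j) = real l} = \<kappa> \<and>
       \<gamma> = (\<lambda>t. \<chi> j. c $ j * t ^ a j)}"

definition N_nondegenerate :: "(complex^'n::finite \<Rightarrow> real) \<Rightarrow> bool" where
  "N_nondegenerate F \<longleftrightarrow> (\<forall>\<kappa>. compact_face F \<kappa> \<longrightarrow>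
      (\<forall>\<gamma> \<in> Gamma_kappa F \<kappa>. \<exists>t. kappa_part F \<kappa> (\<gamma> t) \<noteq> 0))"

definition has_N_canonical_coord :: "(complex^'n::finite) set \<Rightarrow> complex^'n \<Rightarrow> bool" where
  "has_N_canonical_coord M p \<longleftrightarrow> (\<exists>U \<Phi> r'. hol_coord p U \<Phi> \<and>
      local_defining_fun (\<Phi> ` (M \<inter> U)) 0 r' \<and> N_nondegenerate r')"

end

theory Submission
  imports Defs "HOL-Complex_Analysis.Conformal_Mappings"
begin

text \<open>If some defining function in holomorphic coordinates misses the \<open>j\<close>-th axis with its Newton
  polyhedron, then it vanishes to infinite order along that axis, and the axis is a regular curve
  of infinite tangency. Two defining functions of the same hypersurface are bounded by multiples of
  each other, so the tangency holds for \<open>r\<close> as well. Conversely, suppose that the nondegenerate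
  defining function \<open>F\<close> of the canonical coordinate is convenient, and let \<open>c\<^sub>j t ^ a\<^sub>j\<close> be the leading
  terms of a curve. The weight \<open>a\<close> is minimized over the Newton polyhedron, with value \<open>l\<close>, on a
  compact face \<open>\<kappa>\<close>, and \<open>F\<close> restricted to the curve is \<open>F\<^sub>\<kappa> (c t ^ a)\<close>, which is nonzero of order
  \<open>l\<close>, plus terms of order above \<open>l\<close>. Since the polyhedron meets every axis, \<open>l\<close> is at most a
  constant times the order of the curve. Hence each of the conditions forces \<open>F\<close> not to be convenient.\<close>

section \<open>Derivatives of rescaled functions\<close>

text \<open>\<open>F\<close> is merely smooth, so its Taylor series need not converge, and along a
  curve the coefficients at which the quasihomogeneous part is evaluated move with the parameter.
  Hence the expansion is taken in the real scaling variables \<open>s\<close> of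
  \<open>F (scal s z)\<close>, with a remainder uniform for \<open>z\<close> in a ball. Orders and
  coefficients then separate: \<open>s\<close> with entries \<open>\<rho> ^ a j\<close> carries the
  orders, and \<open>z\<close> carries the convergent coefficients. Nondegeneracy speaks of curves
  all of whose coefficients are nonzero, whereas a component of a given curve may vanish
  identically. Filling it with a high power of \<open>t\<close> is harmless only if the bound on the
  order is known before the power is chosen. So the constant must depend on \<open>F\<close> alone;
  it is the sum of the exponents of chosen support points, one on each axis. Defining functions in
  different coordinates are compared through Lipschitz estimates and a one-dimensional search for a
  zero, instead of by dividing one smooth function by another.\<close>

lemma dderiv_eq:
  assumes "(f has_derivative D) (at x)"
  shows "dderiv v f x = D v"
proof -
  interpret D: bounded_linear D
    using assms by (rule has_derivative_bounded_linear)
  have "((\<lambda>t::real. f (x + t *\<^sub>R v)) has_derivative (\<lambda>t. D (t *\<^sub>R v))) (at 0)"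
    by (rule has_derivative_compose[where f = "\<lambda>t::real. x + t *\<^sub>R v" and x = 0])
      (auto intro!: derivative_eq_intros simp: assms)
  then have "((\<lambda>t::real. f (x + t *\<^sub>R v)) has_field_derivative D v) (at 0)"
    by (simp add: has_field_derivative_def D.scaleR mult_commute_abs)
  then show ?thesis
    unfolding dderiv_def by (rule DERIV_imp_deriv)
qed

lemma dderivs_append: "dderivs (us @ vs) f = dderivs us (dderivs vs f)"
  by (induction us) auto

text \<open>Formulas for derivatives of \<open>F (scal s z)\<close> hold only while the point stays
  in the domain of \<open>F\<close>; this allows them to be differentiated again.\<close>

lemma dderiv_cong_open:
  assumes "open S" "x \<in> S" "\<And>y. y \<in> S \<Longrightarrow> f y = g y"
  shows "dderiv v f x = dderiv v g x"
proof -
  have "isCont (\<lambda>t::real. x + t *\<^sub>R v) 0"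
    by (intro continuous_intros)
  then have "\<forall>\<^sub>F t::real in nhds 0. x + t *\<^sub>R v \<in> S"
    using assms(1,2) by (auto simp: continuous_within tendsto_def eventually_at_filter eventually_mono
        dest!: spec[of _ S] elim!: eventually_mono)
  then show ?thesis
    unfolding dderiv_def
    by (intro deriv_cong_ev) (auto elim!: eventually_mono simp: assms(3))
qed

lemma smooth_on_differentiable:
  assumes "smooth_on W f" "open W" "x \<in> W" "set vs \<subseteq> Basis"
  shows "dderivs vs f differentiable at x"
  using assms by (auto simp: smooth_on_def differentiable_on_def at_within_open[symmetric])

lemma smooth_on_continuous:
  assumes "smooth_on W f" "set vs \<subseteq> Basis"
  shows "continuous_on W (dderivs vs f)"
  using assms by (auto simp: smooth_on_def intro: differentiable_imp_continuous_on)

text \<open>The rescaling inside \<open>taylor_part\<close>. Real factors commute with conjugation,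
  so the monomial z^alpha conj(z)^beta is multiplied by s^(alpha+beta), and differentiating in
  \<open>s\<close> sorts the Taylor series by multidegree.\<close>

definition scal :: "real^'n \<Rightarrow> complex^'n \<Rightarrow> complex^'n" where
  "scal s z = (\<chi> j. complex_of_real (s $ j) * z $ j)"

lemma scal_nth [simp]: "scal s z $ j = complex_of_real (s $ j) * z $ j"
  by (simp add: scal_def)

lemma scal_0 [simp]: "scal 0 z = 0"
  by (simp add: vec_eq_iff)

lemma norm_scal_le: "norm (scal s z) \<le> norm s * norm z"
proof -
  have "norm (scal s z) \<le> norm (norm s *\<^sub>R z)"
    by (rule norm_le_componentwise_cart)
      (auto simp: norm_mult component_le_norm_cart mult_right_mono)
  then show ?thesis by simp
qed

lemma bounded_linear_scal: "bounded_linear (\<lambda>s. scal s z)"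
proof (rule bounded_linear_intro)
  show "norm (scal s z) \<le> norm s * norm z" for s by (rule norm_scal_le)
qed (auto simp: vec_eq_iff complex_eq_iff algebra_simps)

lemma continuous_on_scal: "continuous_on A (\<lambda>(z, s). scal s z)"
  unfolding scal_def case_prod_beta by (intro continuous_intros)

lemma open_scal_vimage:
  assumes "open W"
  shows "open {s. scal s z \<in> W}"
  using open_vimage[OF assms, of "\<lambda>s. scal s z"] bounded_linear_scal[of z]
  by (simp add: vimage_def linear_continuous_on)

text \<open>Splits the direction in the chain rule into the two real basis vectors of the
  \<open>j\<close>-th complex coordinate, since \<open>smooth_on\<close> speaks of derivatives along
  \<open>Basis\<close>.\<close>

lemma scal_axis: "scal (axis j 1) z = Re (z $ j) *\<^sub>R axis j 1 + Im (z $ j) *\<^sub>R axis j \<i>"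
  by (auto simp: vec_eq_iff axis_def complex_eq_iff)

text \<open>The functions of \<open>(z, s)\<close> that arise from \<open>F (scal s z)\<close> by differentiating in \<open>s\<close>:
  polynomials in the real coordinates of \<open>z\<close> with coefficients the derivatives of \<open>F\<close>.\<close>

inductive scal_deriv :: "(complex^'n \<Rightarrow> real) \<Rightarrow> (complex^'n \<Rightarrow> real^'n \<Rightarrow> real) \<Rightarrow> bool"
  for F where
  base: "set vs \<subseteq> Basis \<Longrightarrow> scal_deriv F (\<lambda>z s. dderivs vs F (scal s z))"
| add: "scal_deriv F g \<Longrightarrow> scal_deriv F h \<Longrightarrow> scal_deriv F (\<lambda>z s. g z s + h z s)"
| Re: "scal_deriv F h \<Longrightarrow> scal_deriv F (\<lambda>z s. Re (z $ j) * h z s)"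
| Im: "scal_deriv F h \<Longrightarrow> scal_deriv F (\<lambda>z s. Im (z $ j) * h z s)"

lemma scal_deriv_differentiable:
  assumes "scal_deriv F h" "smooth_on W F" "open W" "scal s z \<in> W"
  shows "h z differentiable at s"
  using assms(1)
proof induction
  case (base vs)
  have "((\<lambda>s. scal s z) has_derivative (\<lambda>s. scal s z)) (at s)"
    by (rule bounded_linear_imp_has_derivative[OF bounded_linear_scal])
  moreover have "(dderivs vs F has_derivative frechet_derivative (dderivs vs F) (at (scal s z))) (at (scal s z))"
    using smooth_on_differentiable[OF assms(2,3,4) base] by (simp add: frechet_derivative_works)
  ultimately have "((\<lambda>s. dderivs vs F (scal s z)) has_derivative
      (\<lambda>v. frechet_derivative (dderivs vs F) (at (scal s z)) (scal v z))) (at s)"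
    by (rule has_derivative_compose)
  then show ?case by (auto simp: differentiable_def)
qed auto

text \<open>The chain rule in the base case creates the factors \<open>Re (z $ j)\<close> and
  \<open>Im (z $ j)\<close>. They are constant in \<open>s\<close>, so the other cases only carry
  them along.\<close>

lemma scal_deriv_dderiv:
  assumes "scal_deriv F h" "smooth_on W F" "open W"
  shows "\<exists>h'. scal_deriv F h' \<and> (\<forall>z s. scal s z \<in> W \<longrightarrow> dderiv (axis j 1) (h z) s = h' z s)"
  using assms(1)
proof induction
  case (base vs)
  have d: "dderiv (axis j 1) (\<lambda>s. dderivs vs F (scal s z)) s
     = Re (z $ j) * dderivs (axis j 1 # vs) F (scal s z) + Im (z $ j) * dderivs (axis j \<i> # vs) F (scal s z)"
    if "scal s z \<in> W" for z s
  proof -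
    let ?D = "frechet_derivative (dderivs vs F) (at (scal s z))"
    have D: "(dderivs vs F has_derivative ?D) (at (scal s z))"
      using smooth_on_differentiable[OF assms(2,3) that base] by (simp add: frechet_derivative_works)
    interpret D: bounded_linear ?D using D by (rule has_derivative_bounded_linear)
    have "((\<lambda>s. dderivs vs F (scal s z)) has_derivative (\<lambda>v. ?D (scal v z))) (at s)"
      by (rule has_derivative_compose[OF bounded_linear_imp_has_derivative[OF bounded_linear_scal] D])
    then have "dderiv (axis j 1) (\<lambda>s. dderivs vs F (scal s z)) s = ?D (scal (axis j 1) z)"
      by (rule dderiv_eq)
    also have "\<dots> = Re (z $ j) * ?D (axis j 1) + Im (z $ j) * ?D (axis j \<i>)"
      by (simp add: scal_axis D.add D.scaleR)
    finally show ?thesis by (simp add: dderiv_eq[OF D])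
  qed
  show ?case
    by (intro exI[of _ "\<lambda>z s. Re (z $ j) * dderivs (axis j 1 # vs) F (scal s z)
          + Im (z $ j) * dderivs (axis j \<i> # vs) F (scal s z)"] conjI allI impI d
        scal_deriv.add scal_deriv.Re scal_deriv.Im scal_deriv.base)
      (use base in \<open>auto simp: Basis_complex_def\<close>)
next
  case (add g h)
  then obtain g' h' where
    g': "scal_deriv F g'" "\<And>z s. scal s z \<in> W \<Longrightarrow> dderiv (axis j 1) (g z) s = g' z s" and
    h': "scal_deriv F h'" "\<And>z s. scal s z \<in> W \<Longrightarrow> dderiv (axis j 1) (h z) s = h' z s"
    by blast
  have "dderiv (axis j 1) (\<lambda>s. g z s + h z s) s = g' z s + h' z s" if "scal s z \<in> W" for z s
  proof -
    have "(g z has_derivative frechet_derivative (g z) (at s)) (at s)"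
         "(h z has_derivative frechet_derivative (h z) (at s)) (at s)"
      using scal_deriv_differentiable[OF _ assms(2,3) that] add.hyps
      by (simp_all add: frechet_derivative_works)
    note D = this
    show ?thesis
      using dderiv_eq[OF has_derivative_add[OF D]] dderiv_eq[OF D(1)] dderiv_eq[OF D(2)] g'(2) h'(2) that
      by metis
  qed
  then show ?case using scal_deriv.add[OF g'(1) h'(1)] by blast
next
  case (Re h i)
  then obtain h' where
    h': "scal_deriv F h'" "\<And>z s. scal s z \<in> W \<Longrightarrow> dderiv (axis j 1) (h z) s = h' z s"
    by blast
  have "dderiv (axis j 1) (\<lambda>s. Re (z $ i) * h z s) s = Re (z $ i) * h' z s" if "scal s z \<in> W" for z s
  proof -
    have D: "(h z has_derivative frechet_derivative (h z) (at s)) (at s)"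
      using scal_deriv_differentiable[OF _ assms(2,3) that] Re.hyps
      by (simp add: frechet_derivative_works)
    show ?thesis
      using dderiv_eq[OF has_derivative_mult_right[OF D]] dderiv_eq[OF D] h'(2) that
      by metis
  qed
  then show ?case using scal_deriv.Re[OF h'(1)] by blast
next
  case (Im h i)
  then obtain h' where
    h': "scal_deriv F h'" "\<And>z s. scal s z \<in> W \<Longrightarrow> dderiv (axis j 1) (h z) s = h' z s"
    by blast
  have "dderiv (axis j 1) (\<lambda>s. Im (z $ i) * h z s) s = Im (z $ i) * h' z s" if "scal s z \<in> W" for z s
  proof -
    have D: "(h z has_derivative frechet_derivative (h z) (at s)) (at s)"
      using scal_deriv_differentiable[OF _ assms(2,3) that] Im.hyps
      by (simp add: frechet_derivative_works)
    show ?thesis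
      using dderiv_eq[OF has_derivative_mult_right[OF D]] dderiv_eq[OF D] h'(2) that
      by metis
  qed
  then show ?case using scal_deriv.Im[OF h'(1)] by blast
qed

lemma scal_deriv_continuous:
  assumes "scal_deriv F h" "smooth_on W F"
  shows "continuous_on {(z, s). scal s z \<in> W} (\<lambda>(z, s). h z s)"
  using assms(1)
proof induction
  case (base vs)
  have "continuous_on {(z, s). scal s z \<in> W} (\<lambda>x. dderivs vs F ((\<lambda>(z, s). scal s z) x))"
    by (rule continuous_on_compose2[OF smooth_on_continuous[OF assms(2) base] continuous_on_scal]) auto
  then show ?case by (simp add: case_prod_unfold)
qed (auto simp: case_prod_beta intro!: continuous_intros)

text \<open>The representative \<open>h\<close> is chosen before \<open>z\<close> and
  \<open>s\<close>; its joint continuity is the source of all later uniformity.\<close>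

lemma dderivs_scal:
  assumes "smooth_on W F" "open W" "set vs \<subseteq> range (\<lambda>j. axis j 1)"
  shows "\<exists>h. scal_deriv F h \<and> (\<forall>z s. scal s z \<in> W \<longrightarrow> dderivs vs (\<lambda>s. F (scal s z)) s = h z s)"
  using assms(3)
proof (induction vs)
  case Nil
  show ?case using scal_deriv.base[of "[]" F] by auto
next
  case (Cons v vs)
  then obtain h where h: "scal_deriv F h"
    "\<And>z s. scal s z \<in> W \<Longrightarrow> dderivs vs (\<lambda>s. F (scal s z)) s = h z s" by auto
  obtain j where j: "v = axis j 1" using Cons.prems by auto
  obtain h' where h': "scal_deriv F h'" "\<And>z s. scal s z \<in> W \<Longrightarrow> dderiv (axis j 1) (h z) s = h' z s"
    using scal_deriv_dderiv[OF h(1) assms(1,2)] by blast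
  have "dderivs (v # vs) (\<lambda>s. F (scal s z)) s = h' z s" if "scal s z \<in> W" for z s
    using dderiv_cong_open[OF open_scal_vimage[OF assms(2)], of s z "dderivs vs (\<lambda>s. F (scal s z))" "h z" v]
      h(2) h'(2) that by (simp add: j)
  with h'(1) show ?case by blast
qed

lemma dderivs_scal_differentiable:
  assumes "smooth_on W F" "open W" "set vs \<subseteq> range (\<lambda>j. axis j 1)" "scal s z \<in> W"
  shows "dderivs vs (\<lambda>s. F (scal s z)) differentiable at s"
proof -
  obtain h where h: "scal_deriv F h"
    "\<And>z s. scal s z \<in> W \<Longrightarrow> dderivs vs (\<lambda>s. F (scal s z)) s = h z s"
    using dderivs_scal[OF assms(1-3)] by auto
  have "(h z has_derivative frechet_derivative (h z) (at s)) (at s)"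
    using scal_deriv_differentiable[OF h(1) assms(1,2,4)] by (simp add: frechet_derivative_works)
  then have "(dderivs vs (\<lambda>s. F (scal s z)) has_derivative frechet_derivative (h z) (at s)) (at s)"
    by (rule has_derivative_transform_within_open[OF _ open_scal_vimage[OF assms(2), of z]])
      (use h(2) assms(4) in auto)
  then show ?thesis by (auto simp: differentiable_def)
qed

text \<open>One bound for all \<open>z\<close> in \<open>B\<close>, by joint continuity on the
  compact product. A separate bound for each \<open>z\<close> would be too weak, because
  \<open>z\<close> will move along a curve.\<close>

lemma dderivs_scal_bounded:
  assumes "smooth_on W F" "open W" "set vs \<subseteq> range (\<lambda>j. axis j 1)"
    and "compact B" "compact Q" "\<And>z s. z \<in> B \<Longrightarrow> s \<in> Q \<Longrightarrow> scal s z \<in> W"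
  shows "\<exists>K. \<forall>z\<in>B. \<forall>s\<in>Q. \<bar>dderivs vs (\<lambda>s. F (scal s z)) s\<bar> \<le> K"
proof -
  obtain h where h: "scal_deriv F h"
    "\<And>z s. scal s z \<in> W \<Longrightarrow> dderivs vs (\<lambda>s. F (scal s z)) s = h z s"
    using dderivs_scal[OF assms(1-3)] by auto
  have "compact ((\<lambda>(z, s). h z s) ` (B \<times> Q))"
    using assms(4-6)
    by (intro compact_continuous_image continuous_on_subset[OF scal_deriv_continuous[OF h(1) assms(1)]]
        compact_Times) auto
  then obtain K where "\<And>x. x \<in> (\<lambda>(z, s). h z s) ` (B \<times> Q) \<Longrightarrow> norm x \<le> K"
    using compact_imp_bounded bounded_iff by metis
  then show ?thesis using h(2) assms(6) by (fastforce intro!: exI[of _ K])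
qed

lemma dderivs_scal_continuous:
  assumes "smooth_on W F" "open W" "set vs \<subseteq> range (\<lambda>j. axis j 1)" "0 \<in> W"
  shows "continuous_on UNIV (\<lambda>z. dderivs vs (\<lambda>s. F (scal s z)) 0)"
proof -
  obtain h where h: "scal_deriv F h"
    "\<And>z s. scal s z \<in> W \<Longrightarrow> dderivs vs (\<lambda>s. F (scal s z)) s = h z s"
    using dderivs_scal[OF assms(1-3)] by auto
  have "continuous_on UNIV (\<lambda>z. (\<lambda>(z, s). h z s) (z, 0))"
    by (rule continuous_on_compose2[OF scal_deriv_continuous[OF h(1) assms(1)]])
      (use assms(4) in \<open>auto intro!: continuous_intros\<close>)
  then show ?thesis using h(2) assms(4) by simp
qed

section \<open>Taylor expansion in the order of a multi-index\<close>

definition zero_at :: "'n \<Rightarrow> real^'n \<Rightarrow> real^'n" where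
  "zero_at j s = (\<chi> i. if i = j then 0 else s $ i)"

lemma zero_at_nth [simp]: "zero_at j s $ i = (if i = j then 0 else s $ i)"
  by (simp add: zero_at_def)

lemma norm_zero_at_le: "norm (zero_at j s) \<le> norm s"
  by (rule norm_le_componentwise_cart) auto

text \<open>Keeps in \<open>Q\<close> both the point with one coordinate deleted and the unknown
  intermediate point of Maclaurin's formula. Balls around 0 have this property.\<close>

definition shrink_closed :: "(real^'n) set \<Rightarrow> bool" where
  "shrink_closed Q \<longleftrightarrow> (\<forall>s\<in>Q. \<forall>s'. (\<forall>i. \<bar>s' $ i\<bar> \<le> \<bar>s $ i\<bar>) \<longrightarrow> s' \<in> Q)"

text \<open>Maclaurin's formula on the segment from \<open>zero_at j s\<close> to \<open>s\<close>.
  Of the intermediate point \<open>s'\<close> only its membership in \<open>Q\<close> is retained,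
  which is enough to bound the remainder.\<close>

lemma taylor_coordinate:
  fixes H :: "real^'n \<Rightarrow> real"
  assumes "shrink_closed Q" "s \<in> Q"
    and diff: "\<And>x vs. x \<in> Q \<Longrightarrow> set vs \<subseteq> {axis j 1} \<Longrightarrow> dderivs vs H differentiable at x"
  shows "\<exists>s'\<in>Q. H s = (\<Sum>k<N. dderivs (replicate k (axis j 1)) H (zero_at j s) / fact k * (s $ j) ^ k)
     + dderivs (replicate N (axis j 1)) H s' / fact N * (s $ j) ^ N"
proof -
  define line where "line \<tau> = zero_at j s + \<tau> *\<^sub>R axis j 1" for \<tau>
  define D where "D k \<tau> = dderivs (replicate k (axis j 1)) H (line \<tau>)" for k \<tau>
  have line_Q: "line \<tau> \<in> Q" if "\<bar>\<tau>\<bar> \<le> \<bar>s $ j\<bar>" for \<tau>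
    using assms(1,2) that unfolding shrink_closed_def
    by (auto simp: line_def axis_def elim!: ballE[of _ _ s])
  have "(D k has_real_derivative D (Suc k) \<tau>) (at \<tau>)" if "\<bar>\<tau>\<bar> \<le> \<bar>s $ j\<bar>" for k \<tau>
  proof -
    let ?g = "dderivs (replicate k (axis j 1)) H"
    let ?L = "frechet_derivative ?g (at (line \<tau>))"
    have L: "(?g has_derivative ?L) (at (line \<tau>))"
      using diff[OF line_Q[OF that], of "replicate k (axis j 1)"]
      by (simp add: frechet_derivative_works set_replicate_conv_if)
    interpret L: bounded_linear ?L using L by (rule has_derivative_bounded_linear)
    have "(line has_derivative (\<lambda>h. h *\<^sub>R axis j 1)) (at \<tau>)"
      unfolding line_def by (auto intro!: derivative_eq_intros)
    from has_derivative_compose[OF this L]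
    have "(D k has_derivative (\<lambda>h. ?L (h *\<^sub>R axis j 1))) (at \<tau>)" unfolding D_def .
    then show ?thesis
      using dderiv_eq[OF L, of "axis j 1"]
      by (simp add: has_field_derivative_def D_def L.scaleR mult_commute_abs)
  qed
  then obtain \<tau> where "\<bar>\<tau>\<bar> \<le> \<bar>s $ j\<bar>"
    "D 0 (s $ j) = (\<Sum>k<N. D k 0 / fact k * (s $ j) ^ k) + D N \<tau> / fact N * (s $ j) ^ N"
    using Maclaurin_bi_le[of D "D 0" N "s $ j"] by blast
  moreover have "line (s $ j) = s" by (auto simp: line_def vec_eq_iff axis_def)
  moreover have "line 0 = zero_at j s" by (simp add: line_def)
  ultimately show ?thesis using line_Q by (intro bexI[of _ "line \<tau>"]) (simp_all add: D_def)
qed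

text \<open>A box rather than a bound on the total degree, since expanding one coordinate after the
  other yields a product of ranges. Coordinates not yet expanded have exponent 0.\<close>

definition multi_box :: "nat \<Rightarrow> 'n set \<Rightarrow> ('n \<Rightarrow> nat) set" where
  "multi_box N A = {m. \<forall>i. if i \<in> A then m i < N else m i = 0}"

lemma sum_multi_box_insert:
  fixes f :: "('n \<Rightarrow> nat) \<Rightarrow> 'b::comm_monoid_add"
  assumes "j \<notin> A"
  shows "sum f (multi_box N (insert j A)) = (\<Sum>k<N. \<Sum>m\<in>multi_box N A. f (m(j := k)))"
proof -
  have m0: "m j = 0" if "m \<in> multi_box N A" for m
    using that assms by (auto simp: multi_box_def)
  have "(\<Sum>k<N. \<Sum>m\<in>multi_box N A. f (m(j := k))) = (\<Sum>(k, m)\<in>{..<N} \<times> multi_box N A. f (m(j := k)))"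
    by (rule sum.cartesian_product)
  also have "\<dots> = sum f (multi_box N (insert j A))"
  proof (rule sum.reindex_bij_witness[where i = "\<lambda>m. (m j, m(j := 0))" and j = "\<lambda>(k, m). m(j := k)"])
    fix x assume "x \<in> {..<N} \<times> multi_box N A"
    then show "(((\<lambda>(k, m). m(j := k)) x) j, ((\<lambda>(k, m). m(j := k)) x)(j := 0)) = x"
      using m0 by (auto simp: fun_upd_idem)
    show "(case x of (k, m) \<Rightarrow> m(j := k)) \<in> multi_box N (insert j A)"
      using \<open>x \<in> _\<close> by (auto simp: multi_box_def split: if_splits)
  next
    fix m assume "m \<in> multi_box N (insert j A)"
    then show "(m j, m(j := 0)) \<in> {..<N} \<times> multi_box N A"
      using assms by (auto simp: multi_box_def split: if_splits)
  qed auto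
  finally show ?thesis by simp
qed

text \<open>\<open>idx_list\<close> with the list of coordinates as a parameter, which opens it to
  induction.\<close>

definition idx_on :: "'n::finite list \<Rightarrow> ('n \<Rightarrow> nat) \<Rightarrow> (real^'n) list" where
  "idx_on js m = concat (map (\<lambda>j. replicate (m j) (axis j 1)) js)"

lemma set_idx_on: "set (idx_on js m) \<subseteq> range (\<lambda>j. axis j 1)"
  by (auto simp: idx_on_def)

text \<open>The end of the list is differentiated first, so the last coordinate is the one to split
  off; hence the reverse induction in \<open>taylor_box\<close>.\<close>

lemma idx_on_snoc:
  assumes "j \<notin> set js"
  shows "idx_on (js @ [j]) (m(j := k)) = idx_on js m @ replicate k (axis j 1)"
  using assms by (auto simp: idx_on_def intro!: arg_cong[where f = concat])

lemma prod_upd: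
  fixes g :: "'n::finite \<Rightarrow> nat \<Rightarrow> 'b::comm_monoid_mult"
  assumes "g j (m j) = 1"
  shows "(\<Prod>i\<in>UNIV. g i ((m(j := k)) i)) = g j k * (\<Prod>i\<in>UNIV. g i (m i))"
proof -
  have "(\<Prod>i\<in>UNIV. g i ((m(j := k)) i)) = g j k * (\<Prod>i\<in>UNIV - {j}. g i (m i))"
    by (subst prod.remove[of _ j]) (auto intro!: arg_cong2[where f = "(*)"] prod.cong)
  moreover have "(\<Prod>i\<in>UNIV. g i (m i)) = (\<Prod>i\<in>UNIV - {j}. g i (m i))"
    using assms by (subst prod.remove[of _ j]) auto
  ultimately show ?thesis by simp
qed

text \<open>Expanding in one coordinate after the other produces the mixed derivatives in exactly the
  order prescribed by the list, so that the symmetry of mixed derivatives is never needed.\<close>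

lemma taylor_box:
  fixes H :: "'z \<Rightarrow> real^'n::finite \<Rightarrow> real"
  assumes Q: "shrink_closed Q" "Q \<subseteq> cball 0 1"
    and diff: "\<And>z s vs. z \<in> B \<Longrightarrow> s \<in> Q \<Longrightarrow> set vs \<subseteq> range (\<lambda>j. axis j 1) \<Longrightarrow>
        dderivs vs (H z) differentiable at s"
    and bdd: "\<And>vs. set vs \<subseteq> range (\<lambda>j. axis j 1) \<Longrightarrow>
        \<exists>K. \<forall>z\<in>B. \<forall>s\<in>Q. \<bar>dderivs vs (H z) s\<bar> \<le> K"
    and "distinct js"
  shows "\<exists>C. \<forall>z\<in>B. \<forall>s\<in>Q. (\<forall>i. i \<notin> set js \<longrightarrow> s $ i = 0) \<longrightarrow>
    \<bar>H z s - (\<Sum>m\<in>multi_box N (set js). (\<Prod>i\<in>UNIV. (s $ i) ^ m i) *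
       (dderivs (idx_on js m) (H z) 0 / (\<Prod>i\<in>UNIV. fact (m i))))\<bar> \<le> C * norm s ^ N"
  using diff bdd \<open>distinct js\<close>
proof (induction js arbitrary: H rule: rev_induct)
  case Nil
  have "multi_box N {} = {\<lambda>_::'n. 0}" by (auto simp: multi_box_def)
  moreover have "s = 0" if "\<forall>i. s $ i = 0" for s :: "real^'n"
    using that by (simp add: vec_eq_iff)
  ultimately show ?case
    by (intro exI[of _ 0]) (auto simp: idx_on_def)
next
  case (snoc j js)
  define e :: "real^'n" where "e = axis j 1"
  have e: "set (replicate k e) \<subseteq> range (\<lambda>j. axis j 1)" for k by (auto simp: e_def)
  define T where "T k m z = dderivs (idx_on js m) (dderivs (replicate k e) (H z)) 0 / (\<Prod>i\<in>UNIV. fact (m i))"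
    for k m z
  \<comment> \<open>Induction hypothesis for the coefficients of the expansion in coordinate
    \<open>j\<close>, which are themselves iterated derivatives of \<open>H\<close>.\<close>
  have "\<And>k. \<exists>C. \<forall>z\<in>B. \<forall>s\<in>Q. (\<forall>i. i \<notin> set js \<longrightarrow> s $ i = 0) \<longrightarrow>
    \<bar>dderivs (replicate k e) (H z) s - (\<Sum>m\<in>multi_box N (set js). (\<Prod>i\<in>UNIV. (s $ i) ^ m i) * T k m z)\<bar>
      \<le> C * norm s ^ N"
    unfolding T_def
  proof (rule snoc.IH)
    fix k z s and vs :: "(real^'n) list"
    assume "z \<in> B" "s \<in> Q" "set vs \<subseteq> range (\<lambda>j. axis j 1)"
    then show "dderivs vs (dderivs (replicate k e) (H z)) differentiable at s"
      using snoc.prems(1)[of z s "vs @ replicate k e"] e[of k] by (simp add: dderivs_append)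
  next
    fix k and vs :: "(real^'n) list" assume "set vs \<subseteq> range (\<lambda>j. axis j 1)"
    then show "\<exists>K. \<forall>z\<in>B. \<forall>s\<in>Q. \<bar>dderivs vs (dderivs (replicate k e) (H z)) s\<bar> \<le> K"
      using snoc.prems(2)[of "vs @ replicate k e"] e[of k] by (simp add: dderivs_append)
  next
    show "distinct js" using snoc.prems(3) by simp
  qed
  then have "\<forall>k. \<exists>C. \<forall>z\<in>B. \<forall>s\<in>Q. (\<forall>i. i \<notin> set js \<longrightarrow> s $ i = 0) \<longrightarrow>
    \<bar>dderivs (replicate k e) (H z) s - (\<Sum>m\<in>multi_box N (set js). (\<Prod>i\<in>UNIV. (s $ i) ^ m i) * T k m z)\<bar>
      \<le> C * norm s ^ N" by blast
  from choice[OF this] obtain C where C: "\<And>k z s. z \<in> B \<Longrightarrow> s \<in> Q \<Longrightarrow> (\<forall>i. i \<notin> set js \<longrightarrow> s $ i = 0) \<Longrightarrow>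
    \<bar>dderivs (replicate k e) (H z) s - (\<Sum>m\<in>multi_box N (set js). (\<Prod>i\<in>UNIV. (s $ i) ^ m i) * T k m z)\<bar>
      \<le> C k * norm s ^ N"
    by blast
  obtain K where K: "\<And>z s. z \<in> B \<Longrightarrow> s \<in> Q \<Longrightarrow> \<bar>dderivs (replicate N e) (H z) s\<bar> \<le> K"
    using snoc.prems(2)[OF e[of N]] by blast
  have j: "j \<notin> set js" using snoc.prems(3) by simp
  show ?case
  \<comment> \<open>\<open>C k\<close> comes from expanding the \<open>k\<close>-th coefficient,
    \<open>K\<close> from the Maclaurin remainder. Absolute values are taken because neither is
    known to be nonnegative.\<close>
  proof (intro exI[of _ "(\<Sum>k<N. \<bar>C k\<bar>) + \<bar>K\<bar>"] ballI impI)
    fix z s assume z: "z \<in> B" and s: "s \<in> Q" and supp: "\<forall>i. i \<notin> set (js @ [j]) \<longrightarrow> s $ i = 0"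
    define P where "P k = (\<Sum>m\<in>multi_box N (set js). (\<Prod>i\<in>UNIV. (zero_at j s $ i) ^ m i) * T k m z)" for k
    have sQ: "zero_at j s \<in> Q" using Q(1) s by (auto simp: shrink_closed_def elim!: ballE[of _ _ s])
    \<comment> \<open>With \<open>\<bar>s $ j\<bar> \<le> 1\<close> the powers that multiply the
      coefficient errors cannot enlarge them.\<close>
    have "norm s \<le> 1" using Q(2) s by auto
    then have sj: "\<bar>s $ j\<bar> \<le> 1" "\<bar>s $ j\<bar> \<le> norm s"
      using component_le_norm_cart[of s j] by auto
    obtain s' where s': "s' \<in> Q" and tay:
      "H z s = (\<Sum>k<N. dderivs (replicate k e) (H z) (zero_at j s) / fact k * (s $ j) ^ k)
       + dderivs (replicate N e) (H z) s' / fact N * (s $ j) ^ N"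
      using taylor_coordinate[OF Q(1) s, of j "H z" N] snoc.prems(1)[OF z] unfolding e_def by blast
    have summand: "(\<Prod>i\<in>UNIV. (s $ i) ^ (m(j := k)) i) *
        (dderivs (idx_on (js @ [j]) (m(j := k))) (H z) 0 / (\<Prod>i\<in>UNIV. fact ((m(j := k)) i)))
      = ((s $ j) ^ k / fact k) * ((\<Prod>i\<in>UNIV. (zero_at j s $ i) ^ m i) * T k m z)"
      if "m \<in> multi_box N (set js)" for k m
    proof -
      have mj: "m j = 0" using that j by (auto simp: multi_box_def)
      have 1: "(\<Prod>i\<in>UNIV. (s $ i) ^ (m(j := k)) i) = (s $ j) ^ k * (\<Prod>i\<in>UNIV. (s $ i) ^ m i)"
        by (rule prod_upd[of "\<lambda>i k. (s $ i) ^ k"]) (simp add: mj)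
      have 2: "(\<Prod>i\<in>UNIV. fact ((m(j := k)) i)) = (fact k :: real) * (\<Prod>i\<in>UNIV. fact (m i))"
        by (rule prod_upd[of "\<lambda>i k. fact k"]) (simp add: mj)
      have 3: "(\<Prod>i\<in>UNIV. (s $ i) ^ m i) = (\<Prod>i\<in>UNIV. (zero_at j s $ i) ^ m i)"
        by (rule prod.cong) (auto simp: mj)
      show ?thesis
        unfolding 1 2 3 T_def idx_on_snoc[OF j] dderivs_append e_def by simp
    qed
    have sum: "(\<Sum>m\<in>multi_box N (set (js @ [j])). (\<Prod>i\<in>UNIV. (s $ i) ^ m i) *
       (dderivs (idx_on (js @ [j]) m) (H z) 0 / (\<Prod>i\<in>UNIV. fact (m i))))
      = (\<Sum>k<N. (s $ j) ^ k / fact k * P k)"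
    proof -
      have js: "set (js @ [j]) = insert j (set js)" by simp
      show ?thesis
        unfolding js sum_multi_box_insert[OF j] P_def sum_distrib_left
        by (intro sum.cong refl summand)
    qed
    have small: "\<bar>x / fact k * (s $ j) ^ k\<bar> \<le> \<bar>x\<bar> * \<bar>s $ j\<bar> ^ k" for x k
    proof -
      have "\<bar>x / fact k * (s $ j) ^ k\<bar> = \<bar>x\<bar> * \<bar>s $ j\<bar> ^ k / fact k" by (simp add: abs_mult power_abs)
      also have "\<dots> \<le> \<bar>x\<bar> * \<bar>s $ j\<bar> ^ k / 1" by (rule divide_left_mono) (auto simp: fact_ge_1)
      finally show ?thesis by simp
    qed
    have "H z s - (\<Sum>k<N. (s $ j) ^ k / fact k * P k)
      = (\<Sum>k<N. (dderivs (replicate k e) (H z) (zero_at j s) - P k) / fact k * (s $ j) ^ k)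
       + dderivs (replicate N e) (H z) s' / fact N * (s $ j) ^ N"
      unfolding tay by (simp add: sum_subtractf diff_divide_distrib algebra_simps)
    also have "\<bar>\<dots>\<bar> \<le> (\<Sum>k<N. \<bar>(dderivs (replicate k e) (H z) (zero_at j s) - P k) / fact k * (s $ j) ^ k\<bar>)
       + \<bar>dderivs (replicate N e) (H z) s' / fact N * (s $ j) ^ N\<bar>"
      by (rule order_trans[OF abs_triangle_ineq]) (intro add_right_mono sum_abs)
    also have "\<dots> \<le> (\<Sum>k<N. \<bar>C k\<bar> * norm s ^ N) + \<bar>K\<bar> * norm s ^ N"
    proof (intro add_mono sum_mono)
      fix k
      have "\<bar>dderivs (replicate k e) (H z) (zero_at j s) - P k\<bar> \<le> C k * norm (zero_at j s) ^ N"
        unfolding P_def by (rule C[OF z sQ]) (use supp in auto)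
      also have "\<dots> \<le> \<bar>C k\<bar> * norm s ^ N"
        by (intro mult_mono power_mono norm_zero_at_le) auto
      finally have X: "\<bar>dderivs (replicate k e) (H z) (zero_at j s) - P k\<bar> * \<bar>s $ j\<bar> ^ k \<le> \<bar>C k\<bar> * norm s ^ N * 1"
        using sj(1) by (intro mult_mono power_le_one) auto
      show "\<bar>(dderivs (replicate k e) (H z) (zero_at j s) - P k) / fact k * (s $ j) ^ k\<bar>
          \<le> \<bar>C k\<bar> * norm s ^ N"
        using order_trans[OF small X] by simp
    next
      have Y: "\<bar>dderivs (replicate N e) (H z) s'\<bar> * \<bar>s $ j\<bar> ^ N \<le> \<bar>K\<bar> * norm s ^ N"
        using K[OF z s'] sj(2) by (intro mult_mono power_mono) auto
      show "\<bar>dderivs (replicate N e) (H z) s' / fact N * (s $ j) ^ N\<bar> \<le> \<bar>K\<bar> * norm s ^ N"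
        by (rule order_trans[OF small Y])
    qed
    also have "\<dots> = ((\<Sum>k<N. \<bar>C k\<bar>) + \<bar>K\<bar>) * norm s ^ N"
      by (simp only: sum_distrib_right distrib_right)
    finally show "\<bar>H z s - (\<Sum>m\<in>multi_box N (set (js @ [j])). (\<Prod>i\<in>UNIV. (s $ i) ^ m i) *
       (dderivs (idx_on (js @ [j]) m) (H z) 0 / (\<Prod>i\<in>UNIV. fact (m i))))\<bar>
       \<le> ((\<Sum>k<N. \<bar>C k\<bar>) + \<bar>K\<bar>) * norm s ^ N"
      unfolding sum .
  qed
qed

lemma enum_idx: "set (enum_idx :: 'n::finite list) = UNIV" "distinct (enum_idx :: 'n list)"
proof -
  have "\<exists>xs :: 'n list. set xs = UNIV \<and> distinct xs" by (rule finite_distinct_list) simp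
  from someI_ex[OF this] show "set (enum_idx :: 'n list) = UNIV" "distinct (enum_idx :: 'n list)"
    by (auto simp: enum_idx_def)
qed

lemma taylor_part_alt:
  "taylor_part F m z = dderivs (idx_on enum_idx m) (\<lambda>s. F (scal s z)) 0 / (\<Prod>i\<in>UNIV. fact (m i))"
  by (simp add: taylor_part_def idx_list_def idx_on_def scal_def)

lemma continuous_taylor_part:
  assumes "smooth_on W F" "open W" "0 \<in> W"
  shows "continuous_on UNIV (taylor_part F m)"
  unfolding taylor_part_alt
  by (intro continuous_intros dderivs_scal_continuous[OF assms(1,2) set_idx_on assms(3)]) simp

lemma taylor_scal:
  fixes F :: "complex^'n::finite \<Rightarrow> real"
  assumes "smooth_on W F" "open W" "0 \<in> W"
  shows "\<exists>\<delta>>0. \<exists>C. \<forall>z\<in>cball 0 R. \<forall>s\<in>cball 0 \<delta>.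
    \<bar>F (scal s z) - (\<Sum>m\<in>multi_box N UNIV. (\<Prod>i\<in>UNIV. (s $ i) ^ m i) * taylor_part F m z)\<bar> \<le> C * norm s ^ N"
proof -
  obtain \<epsilon> where \<epsilon>: "\<epsilon> > 0" "ball 0 \<epsilon> \<subseteq> W"
    using assms(2,3) by (meson open_contains_ball)
  \<comment> \<open>For \<open>z\<close> in \<open>cball 0 R\<close> this gives
    \<open>norm (scal s z) \<le> \<delta> * \<bar>R\<bar> < \<epsilon>\<close>. The summand 1 keeps
    the denominator positive, and the cap at 1 serves \<open>taylor_box\<close>.\<close>
  define \<delta> where "\<delta> = min 1 (\<epsilon> / (\<bar>R\<bar> + 1))"
  have \<delta>: "\<delta> > 0" "\<delta> \<le> 1" "\<delta> \<le> \<epsilon> / (\<bar>R\<bar> + 1)" using \<epsilon>(1) by (auto simp: \<delta>_def)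
  have in_W: "scal s z \<in> W" if "z \<in> cball 0 R" "s \<in> cball 0 \<delta>" for z s
  proof -
    have "norm (scal s z) \<le> norm s * norm z" by (rule norm_scal_le)
    also have "\<dots> \<le> \<delta> * \<bar>R\<bar>" using that \<delta> by (intro mult_mono) auto
    also have "\<dots> < \<delta> * (\<bar>R\<bar> + 1)" using \<delta>(1) by simp
    also have "\<dots> \<le> \<epsilon>" using \<delta>(3) by (simp add: field_simps)
    finally show ?thesis using \<epsilon>(2) by auto
  qed
  have shrink: "shrink_closed (cball (0 :: real^'n) \<delta>)"
    unfolding shrink_closed_def
  proof (intro ballI allI impI)
    fix s s' :: "real^'n" assume "s \<in> cball 0 \<delta>" "\<forall>i. \<bar>s' $ i\<bar> \<le> \<bar>s $ i\<bar>"
    moreover then have "norm s' \<le> norm s" by (intro norm_le_componentwise_cart) auto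
    ultimately show "s' \<in> cball 0 \<delta>" by simp
  qed
  have "\<exists>C. \<forall>z\<in>cball 0 R. \<forall>s\<in>cball 0 \<delta>. (\<forall>i. i \<notin> set enum_idx \<longrightarrow> s $ i = 0) \<longrightarrow>
    \<bar>F (scal s z) - (\<Sum>m\<in>multi_box N (set enum_idx). (\<Prod>i\<in>UNIV. (s $ i) ^ m i) *
       (dderivs (idx_on enum_idx m) (\<lambda>s. F (scal s z)) 0 / (\<Prod>i\<in>UNIV. fact (m i))))\<bar> \<le> C * norm s ^ N"
    by (rule taylor_box[OF shrink _ _ _ enum_idx(2)])
      (use \<delta>(2) in_W in \<open>auto intro: dderivs_scal_differentiable[OF assms(1,2)]
        dderivs_scal_bounded[OF assms(1,2) _ compact_cball compact_cball]\<close>)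
  then show ?thesis using \<delta>(1) by (auto simp: enum_idx taylor_part_alt)
qed

section \<open>Faces of the Newton polyhedron\<close>

text \<open>The power of \<open>\<rho>\<close> that the multidegree \<open>m\<close> acquires when
  coordinate \<open>j\<close> is scaled by \<open>\<rho> ^ a j\<close>; equally, the linear
  functional whose minimum cuts out a face.\<close>

definition weight :: "('n::finite \<Rightarrow> nat) \<Rightarrow> ('n \<Rightarrow> nat) \<Rightarrow> nat" where
  "weight a m = (\<Sum>j\<in>UNIV. a j * m j)"

lemma newton_poly_I:
  assumes "m \<in> supp_S F"
  shows "mvec m \<in> newton_poly F"
  unfolding newton_poly_def
  by (rule hull_inc) (use assms in \<open>auto simp: mvec_def\<close>)

lemma newton_poly_minimal:
  assumes "convex C" "\<And>m \<xi>. m \<in> supp_S F \<Longrightarrow> (\<And>j. real (m j) \<le> \<xi> $ j) \<Longrightarrow> \<xi> \<in> C"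
  shows "newton_poly F \<subseteq> C"
  unfolding newton_poly_def by (rule hull_minimal) (use assms in auto)

text \<open>If no support point lies on the axis, each has an integer entry off it that is at least
  1. The half-space where the entries off the axis sum to at least 1 then contains the whole
  polyhedron and misses the axis.\<close>

lemma convenient_iff:
  "convenient F \<longleftrightarrow> (\<forall>j. \<exists>m\<in>supp_S F. \<forall>i. i \<noteq> j \<longrightarrow> m i = 0)"
proof
  assume R: "\<forall>j. \<exists>m\<in>supp_S F. \<forall>i. i \<noteq> j \<longrightarrow> m i = 0"
  show "convenient F"
    unfolding convenient_def
  proof
    fix j
    obtain m where "m \<in> supp_S F" "\<forall>i. i \<noteq> j \<longrightarrow> m i = 0" using R by blast
    then show "\<exists>\<xi>\<in>newton_poly F. \<forall>i. i \<noteq> j \<longrightarrow> \<xi> $ i = 0"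
      by (intro bexI[OF _ newton_poly_I]) (auto simp: mvec_def)
  qed
next
  assume L: "convenient F"
  show "\<forall>j. \<exists>m\<in>supp_S F. \<forall>i. i \<noteq> j \<longrightarrow> m i = 0"
  proof (rule allI, rule ccontr)
    fix j assume no: "\<not> (\<exists>m\<in>supp_S F. \<forall>i. i \<noteq> j \<longrightarrow> m i = 0)"
    define v :: "real^'a" where "v = (\<chi> i. if i = j then 0 else 1)"
    have v: "v \<bullet> \<xi> = (\<Sum>i\<in>UNIV - {j}. \<xi> $ i)" for \<xi>
      by (auto simp: inner_vec_def v_def intro!: sum.mono_neutral_cong_right split: if_splits)
    have "newton_poly F \<subseteq> {\<xi>. v \<bullet> \<xi> \<ge> 1}"
    proof (rule newton_poly_minimal)
      show "convex {\<xi>. v \<bullet> \<xi> \<ge> 1}" by (rule convex_halfspace_ge)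
      fix m \<xi> assume m: "m \<in> supp_S F" "\<And>j. real (m j) \<le> \<xi> $ j"
      then obtain i where i: "i \<noteq> j" "m i \<noteq> 0" using no by blast
      have "1 \<le> real (m i)" using i by simp
      also have "\<dots> \<le> \<xi> $ i" by (rule m(2))
      also have "\<dots> \<le> (\<Sum>i\<in>UNIV - {j}. \<xi> $ i)"
        using i m(2) order_trans[OF of_nat_0_le_iff] by (intro member_le_sum) auto
      finally show "\<xi> \<in> {\<xi>. v \<bullet> \<xi> \<ge> 1}" by (simp add: v)
    qed
    moreover obtain \<xi> where "\<xi> \<in> newton_poly F" "\<forall>i. i \<noteq> j \<longrightarrow> \<xi> $ i = 0"
      using L unfolding convenient_def by blast
    moreover then have "v \<bullet> \<xi> = 0" by (auto simp: v)
    ultimately show False by auto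
  qed
qed

text \<open>A convex combination of points of weight at least \<open>l\<close> that has weight exactly \<open>l\<close> only
  involves points of weight \<open>l\<close>; this makes the face a polytope.\<close>

lemma face_is_polytope:
  fixes F :: "complex^'n::finite \<Rightarrow> real"
  assumes a: "\<And>j. a j > 0" and l: "\<And>m. m \<in> supp_S F \<Longrightarrow> l \<le> weight a m"
  defines "A \<equiv> (\<chi> j. real (a j)) :: real^'n"
  shows "newton_poly F \<subseteq> {\<xi>. A \<bullet> \<xi> \<ge> real l}"
    and "newton_poly F \<inter> {\<xi>. A \<bullet> \<xi> = real l} = convex hull (mvec ` {m \<in> supp_S F. weight a m = l})"
proof -
  have A: "A \<bullet> \<xi> = (\<Sum>j\<in>UNIV. real (a j) * \<xi> $ j)" for \<xi>
    by (simp add: A_def inner_vec_def)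
  have Am: "A \<bullet> mvec m = real (weight a m)" for m
    by (simp add: A mvec_def weight_def)
  have mono: "real (weight a m) \<le> A \<bullet> \<xi>" if "\<And>j. real (m j) \<le> \<xi> $ j" for m \<xi>
    unfolding Am[symmetric] A by (intro sum_mono mult_left_mono) (auto simp: mvec_def that)
  show ge: "newton_poly F \<subseteq> {\<xi>. A \<bullet> \<xi> \<ge> real l}"
  proof (rule newton_poly_minimal)
    fix m \<xi> assume "m \<in> supp_S F" "\<And>j. real (m j) \<le> \<xi> $ j"
    with l[of m] mono[of m \<xi>] show "\<xi> \<in> {\<xi>. A \<bullet> \<xi> \<ge> real l}" by simp
  qed (rule convex_halfspace_ge)
  let ?K = "convex hull (mvec ` {m \<in> supp_S F. weight a m = l})"
  have K: "?K \<subseteq> {\<xi>. A \<bullet> \<xi> = real l}"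
    by (rule hull_minimal) (auto simp: Am convex_hyperplane)
  have "?K \<subseteq> newton_poly F"
    by (rule hull_minimal) (auto simp: newton_poly_def convex_convex_hull newton_poly_I[unfolded newton_poly_def])
  \<comment> \<open>A convex subset of the bounding hyperplane together with the open half-space is
    convex: a proper combination has both ends in \<open>?K\<close> or one end of weight above
    \<open>l\<close>, and then exceeds \<open>l\<close> itself.\<close>
  moreover have "newton_poly F \<subseteq> ?K \<union> {\<xi>. A \<bullet> \<xi> > real l}"
  proof (rule newton_poly_minimal)
    show "convex (?K \<union> {\<xi>. A \<bullet> \<xi> > real l})"
    proof (subst convex_alt, intro ballI allI impI)
      fix x y u assume x: "x \<in> ?K \<union> {\<xi>. A \<bullet> \<xi> > real l}" and y: "y \<in> ?K \<union> {\<xi>. A \<bullet> \<xi> > real l}"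
        and u: "0 \<le> u \<and> u \<le> (1::real)"
      show "(1 - u) *\<^sub>R x + u *\<^sub>R y \<in> ?K \<union> {\<xi>. A \<bullet> \<xi> > real l}"
      proof (cases "u = 0 \<or> u = 1 \<or> (x \<in> ?K \<and> y \<in> ?K)")
        case True
        then show ?thesis using x y u convexD_alt[OF convex_convex_hull, of x _ y u] by auto
      next
        case False
        then have u: "0 < u" "u < 1" using u by auto
        have xy: "A \<bullet> x \<ge> real l" "A \<bullet> y \<ge> real l" using x y K by auto
        have "(1 - u) * (A \<bullet> x - real l) + u * (A \<bullet> y - real l) > 0"
        proof (cases "x \<in> ?K")
          case True
          then have "A \<bullet> y > real l" using False y by auto
          then show ?thesis using u xy by (intro add_nonneg_pos) auto
        next
          case x': False
          then have "A \<bullet> x > real l" using x by auto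
          then show ?thesis using u xy by (intro add_pos_nonneg) auto
        qed
        then have "A \<bullet> ((1 - u) *\<^sub>R x + u *\<^sub>R y) > real l"
          by (simp add: inner_add_right algebra_simps)
        then show ?thesis by simp
      qed
    qed
    fix m \<xi> assume m: "m \<in> supp_S F" "\<And>j. real (m j) \<le> \<xi> $ j"
    show "\<xi> \<in> ?K \<union> {\<xi>. A \<bullet> \<xi> > real l}"
    proof (cases "A \<bullet> \<xi> > real l")
      case False
      with mono[of m \<xi>] m l[of m] have eq: "A \<bullet> \<xi> = real l" "weight a m = l" by auto
      \<comment> \<open>Equal weights and \<open>m \<le> \<xi>\<close> force equality in every
        coordinate because all weights are positive; a zero weight would let the face run off to
        infinity.\<close>
      have "(\<Sum>j\<in>UNIV. real (a j) * (\<xi> $ j - real (m j))) = 0"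
        using eq Am[of m] by (simp add: A mvec_def algebra_simps sum_subtractf)
      then have "\<forall>j. real (a j) * (\<xi> $ j - real (m j)) = 0"
        by (subst (asm) sum_nonneg_eq_0_iff) (auto simp: m(2))
      then have "\<xi> $ i = real (m i)" for i using a[of i] by (auto dest: spec[of _ i])
      then have "\<xi> = mvec m" by (simp add: vec_eq_iff mvec_def)
      then show ?thesis using m(1) eq(2) by (auto intro: hull_inc)
    qed simp
  qed
  ultimately show "newton_poly F \<inter> {\<xi>. A \<bullet> \<xi> = real l} = ?K"
    using K by fastforce
qed

lemma finite_multi_box: "finite (multi_box N (UNIV :: 'n::finite set))"
proof -
  have "multi_box N UNIV = (PiE UNIV (\<lambda>_. {..<N}) :: ('n \<Rightarrow> nat) set)"
    by (auto simp: multi_box_def PiE_def)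
  then show ?thesis by (simp add: finite_PiE)
qed

text \<open>Positive weights bound each exponent by the total weight. So a face carries finitely
  many multidegrees, all inside the box of the Taylor expansion with bound
  \<open>Suc l\<close>.\<close>

lemma finite_weight:
  assumes "\<And>j. a j > 0"
  shows "finite {m. weight a m = l}" "{m. weight a m = l} \<subseteq> multi_box (Suc l) UNIV"
proof -
  have "m j \<le> weight a m" for m j
  proof -
    have "m j \<le> a j * m j" using assms[of j] by simp
    also have "\<dots> \<le> weight a m" unfolding weight_def by (rule member_le_sum) auto
    finally show ?thesis .
  qed
  then show sub: "{m. weight a m = l} \<subseteq> multi_box (Suc l) UNIV"
    by (auto simp: multi_box_def less_Suc_eq_le)
  show "finite {m. weight a m = l}" by (rule finite_subset[OF sub finite_multi_box])
qed

text \<open>Since \<open>l\<close> is the least weight on the support, its hyperplane supports the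
  polyhedron. The face is nonempty because \<open>m0\<close> attains the minimum and compact because
  it is the hull of finitely many points; the monomial curve belongs to it with these very
  \<open>a\<close> and \<open>l\<close>.\<close>

lemma nondegenerate_weight_part:
  fixes F :: "complex^'n::finite \<Rightarrow> real"
  assumes nd: "N_nondegenerate F" and a: "\<And>j. a j > 0"
    and m0: "m0 \<in> supp_S F" "weight a m0 = l" and l: "\<And>m. m \<in> supp_S F \<Longrightarrow> l \<le> weight a m"
    and c: "\<And>j. c $ j \<noteq> 0"
  shows "\<exists>t. (\<Sum>m | m \<in> supp_S F \<and> weight a m = l. taylor_part F m (\<chi> j. c $ j * t ^ a j)) \<noteq> 0"
proof -
  define A :: "real^'n" where "A = (\<chi> j. real (a j))"
  define \<kappa> where "\<kappa> = newton_poly F \<inter> {\<xi>. A \<bullet> \<xi> = real l}"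
  have A: "A \<bullet> \<xi> = (\<Sum>j\<in>UNIV. real (a j) * \<xi> $ j)" for \<xi>
    by (simp add: A_def inner_vec_def)
  have Am: "A \<bullet> mvec m = real (weight a m)" for m
    by (simp add: A mvec_def weight_def)
  have m\<kappa>: "m \<in> supp_S F \<and> mvec m \<in> \<kappa> \<longleftrightarrow> m \<in> supp_S F \<and> weight a m = l" for m
    by (auto simp: \<kappa>_def Am newton_poly_I)
  have "compact_face F \<kappa>"
    unfolding compact_face_def
  proof (intro conjI)
    show "\<kappa> face_of newton_poly F"
      unfolding \<kappa>_def using face_is_polytope(1)[of a F l, OF a l]
      by (intro face_of_Int_supporting_hyperplane_ge) (auto simp: newton_poly_def A_def)
    have "\<kappa> = convex hull (mvec ` {m \<in> supp_S F. weight a m = l})"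
      unfolding \<kappa>_def A_def by (rule face_is_polytope(2)) (use a l in auto)
    moreover have "finite {m \<in> supp_S F. weight a m = l}"
      by (rule finite_subset[OF _ finite_weight(1)[of a l]]) (use a in auto)
    ultimately show "compact \<kappa>"
      by (simp add: finite_imp_compact_convex_hull)
    show "\<kappa> \<noteq> {}" using m\<kappa>[of m0] m0 by auto
  qed
  moreover have "(\<lambda>t. \<chi> j. c $ j * t ^ a j) \<in> Gamma_kappa F \<kappa>"
    unfolding Gamma_kappa_def \<kappa>_def A using c by (auto intro!: exI[of _ c] exI[of _ a] exI[of _ l])
  ultimately obtain t where "kappa_part F \<kappa> (\<chi> j. c $ j * t ^ a j) \<noteq> 0"
    using nd unfolding N_nondegenerate_def by fastforce
  then show ?thesis unfolding kappa_part_def m\<kappa> by blast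
qed

section \<open>Orders along curves\<close>

text \<open>Multidegrees of weight below \<open>l\<close> have zero Taylor part, those of weight
  \<open>l\<close> form \<open>G\<close>, and the others contribute at least one more factor
  \<open>\<rho>\<close>. As \<open>z\<close> ranges over a ball, the estimate may later be used at a
  point depending on \<open>\<rho>\<close>.\<close>

lemma weighted_expansion:
  fixes F :: "complex^'n::finite \<Rightarrow> real"
  assumes W: "smooth_on W F" "open W" "0 \<in> W"
    and a: "\<And>j. a j > 0" and l: "\<And>m. m \<in> supp_S F \<Longrightarrow> l \<le> weight a m"
  defines "G \<equiv> \<lambda>z. \<Sum>m | m \<in> supp_S F \<and> weight a m = l. taylor_part F m z"
  shows "\<exists>C. \<forall>\<^sub>F \<rho> in at_right 0. \<forall>z\<in>cball 0 R.
    \<bar>F (scal (\<chi> j. \<rho> ^ a j) z) - \<rho> ^ l * G z\<bar> \<le> C * \<rho> ^ Suc l"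
proof -
  let ?box = "multi_box (Suc l) UNIV :: ('n \<Rightarrow> nat) set"
  obtain \<delta> C where \<delta>: "\<delta> > 0" and C: "\<And>z s. z \<in> cball 0 R \<Longrightarrow> s \<in> cball 0 \<delta> \<Longrightarrow>
    \<bar>F (scal s z) - (\<Sum>m\<in>?box. (\<Prod>i\<in>UNIV. (s $ i) ^ m i) * taylor_part F m z)\<bar> \<le> C * norm s ^ Suc l"
    using taylor_scal[OF W, of R "Suc l"] by blast
  have "compact ((\<lambda>z. \<Sum>m\<in>?box. \<bar>taylor_part F m z\<bar>) ` cball 0 R)"
    by (intro compact_continuous_image compact_cball continuous_intros
        continuous_on_subset[OF continuous_taylor_part[OF W]]) auto
  from compact_imp_bounded[OF this, unfolded bounded_iff]
  obtain K where "\<forall>x\<in>(\<lambda>z. \<Sum>m\<in>?box. \<bar>taylor_part F m z\<bar>) ` cball 0 R. norm x \<le> K" ..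
  then have K: "(\<Sum>m\<in>?box. \<bar>taylor_part F m z\<bar>) \<le> K" if "z \<in> cball 0 R" for z
    using that by (auto dest!: bspec[of _ _ z])
  define n where "n = real CARD('n)"
  have n: "n > 0" by (simp add: n_def)
  \<comment> \<open>\<open>K\<close> bounds the terms of higher weight; the other summand is the
    Taylor remainder, as \<open>norm s \<le> n * \<rho>\<close>. The condition
    \<open>\<rho> < 1\<close> gives \<open>\<rho> ^ a j \<le> \<rho>\<close>, and
    \<open>\<rho> < \<delta> / n\<close> keeps \<open>s\<close> in the ball of validity.\<close>
  have "\<bar>F (scal (\<chi> j. \<rho> ^ a j) z) - \<rho> ^ l * G z\<bar> \<le> (\<bar>C\<bar> * n ^ Suc l + K) * \<rho> ^ Suc l"
    if \<rho>: "0 < \<rho>" "\<rho> < min 1 (\<delta> / n)" and z: "z \<in> cball 0 R" for \<rho> z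
  proof -
    define s :: "real^'n" where "s = (\<chi> j. \<rho> ^ a j)"
    have "norm s \<le> (\<Sum>j\<in>UNIV. \<bar>s $ j\<bar>)" by (rule norm_le_l1_cart)
    also have "\<dots> \<le> (\<Sum>j\<in>(UNIV::'n set). \<rho>)"
    proof (rule sum_mono)
      fix j
      have "\<rho> ^ a j \<le> \<rho> ^ 1" using \<rho> a[of j] by (intro power_decreasing) auto
      then show "\<bar>s $ j\<bar> \<le> \<rho>" using \<rho> by (simp add: s_def)
    qed
    also have "\<dots> = n * \<rho>" by (simp add: n_def)
    finally have ns: "norm s \<le> n * \<rho>" .
    then have "norm s \<le> \<delta>" using \<rho> n by (simp add: field_simps)
    have prod: "(\<Prod>i\<in>UNIV. (s $ i) ^ m i) = \<rho> ^ weight a m" for m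
      by (simp add: s_def weight_def power_sum power_mult)
    have sub: "{m. m \<in> supp_S F \<and> weight a m = l} \<subseteq> ?box"
      using finite_weight(2)[of a l] a by auto
    have "\<rho> ^ l * G z = (\<Sum>m | m \<in> supp_S F \<and> weight a m = l. \<rho> ^ weight a m * taylor_part F m z)"
      unfolding G_def sum_distrib_left by (rule sum.cong) auto
    also have "\<dots> = (\<Sum>m\<in>?box. if m \<in> supp_S F \<and> weight a m = l then \<rho> ^ weight a m * taylor_part F m z else 0)"
      using sub finite_multi_box by (intro sum.mono_neutral_cong_left) auto
    finally have "(\<Sum>m\<in>?box. \<rho> ^ weight a m * taylor_part F m z) - \<rho> ^ l * G z
      = (\<Sum>m\<in>?box. if m \<in> supp_S F \<and> weight a m = l then 0 else \<rho> ^ weight a m * taylor_part F m z)"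
      by (simp add: sum_subtractf[symmetric] if_distrib cong: if_cong)
    also have "\<bar>\<dots>\<bar> \<le> (\<Sum>m\<in>?box. \<rho> ^ Suc l * \<bar>taylor_part F m z\<bar>)"
    proof (rule order_trans[OF sum_abs], rule sum_mono)
      fix m
      show "\<bar>if m \<in> supp_S F \<and> weight a m = l then 0 else \<rho> ^ weight a m * taylor_part F m z\<bar>
          \<le> \<rho> ^ Suc l * \<bar>taylor_part F m z\<bar>"
      proof (cases "m \<in> supp_S F")
        case True
        then have "weight a m \<noteq> l \<Longrightarrow> \<rho> ^ weight a m \<le> \<rho> ^ Suc l"
          using l[of m] \<rho> by (intro power_decreasing) auto
        then show ?thesis using True \<rho> by (auto simp: abs_mult intro!: mult_right_mono)
      next
        case False
        then have "taylor_part F m z = 0" by (auto simp: supp_S_def)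
        then show ?thesis by simp
      qed
    qed
    also have "\<dots> \<le> K * \<rho> ^ Suc l"
      unfolding sum_distrib_left[symmetric] using K[OF z] \<rho> by (simp add: mult.commute mult_left_mono)
    finally have 1: "\<bar>(\<Sum>m\<in>?box. \<rho> ^ weight a m * taylor_part F m z) - \<rho> ^ l * G z\<bar> \<le> K * \<rho> ^ Suc l" .
    have "\<bar>F (scal s z) - (\<Sum>m\<in>?box. \<rho> ^ weight a m * taylor_part F m z)\<bar> \<le> C * norm s ^ Suc l"
      using C[of z s] z \<open>norm s \<le> \<delta>\<close> by (simp add: prod)
    also have "\<dots> \<le> \<bar>C\<bar> * (n * \<rho>) ^ Suc l"
      by (intro mult_mono power_mono ns) auto
    finally have 2: "\<bar>F (scal s z) - (\<Sum>m\<in>?box. \<rho> ^ weight a m * taylor_part F m z)\<bar>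
        \<le> \<bar>C\<bar> * n ^ Suc l * \<rho> ^ Suc l"
      by (simp only: power_mult_distrib mult.assoc)
    show ?thesis using 1 2 unfolding s_def[symmetric] distrib_right by linarith
  qed
  then have "\<forall>\<^sub>F \<rho> in at_right 0. \<forall>z\<in>cball 0 R.
    \<bar>F (scal (\<chi> j. \<rho> ^ a j) z) - \<rho> ^ l * G z\<bar> \<le> (\<bar>C\<bar> * n ^ Suc l + K) * \<rho> ^ Suc l"
    unfolding eventually_at_right_field using \<delta> n by (intro exI[of _ "min 1 (\<delta> / n)"]) auto
  then show ?thesis by blast
qed

lemma continuous_weight_part:
  assumes "smooth_on W F" "open W" "0 \<in> W"
  shows "continuous_on UNIV (\<lambda>z. \<Sum>m | m \<in> supp_S F \<and> weight a m = l. taylor_part F m z)"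
  by (intro continuous_intros continuous_taylor_part[OF assms])

text \<open>Along the ray \<open>t = \<rho> t0\<close> the restriction of \<open>F\<close> is \<open>\<rho> ^ l\<close> times the value of its
  quasihomogeneous part at the leading coefficients, up to \<open>O(\<rho> ^ (l + 1))\<close>.\<close>

lemma not_bigo_weight:
  fixes F :: "complex^'n::finite \<Rightarrow> real"
  assumes W: "smooth_on W F" "open W" "0 \<in> W" and nd: "N_nondegenerate F"
    and a: "\<And>j. a j > 0"
    and m0: "m0 \<in> supp_S F" "weight a m0 = l" and l: "\<And>m. m \<in> supp_S F \<Longrightarrow> l \<le> weight a m"
    and c: "\<And>j. c $ j \<noteq> 0" and lim: "\<And>j. ((\<lambda>t. \<delta> t $ j / t ^ a j) \<longlongrightarrow> c $ j) (at 0)"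
  shows "(\<lambda>t. norm (F (\<delta> t))) \<notin> O[at 0](\<lambda>t. norm t ^ Suc l)"
proof
  assume bigo: "(\<lambda>t. norm (F (\<delta> t))) \<in> O[at 0](\<lambda>t. norm t ^ Suc l)"
  define G where "G z = (\<Sum>m | m \<in> supp_S F \<and> weight a m = l. taylor_part F m z)" for z
  have contG: "continuous_on UNIV G"
    unfolding G_def by (rule continuous_weight_part[OF W])
  define h where "h t = G (\<chi> j. c $ j * t ^ a j)" for t
  have "continuous_on UNIV h"
    unfolding h_def by (rule continuous_on_compose2[OF contG]) (auto intro!: continuous_intros)
  then have conth: "(h \<longlongrightarrow> h t) (at t)" for t
    by (simp add: continuous_on_def)
  obtain t1 where t1: "h t1 \<noteq> 0"
    using nondegenerate_weight_part[OF nd, of a m0 l c] a m0 l c unfolding h_def G_def by blast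
  \<comment> \<open>Nondegeneracy might provide only \<open>t1 = 0\<close>, which spans no ray; by
    continuity a nearby parameter also works.\<close>
  obtain t0 where t0: "t0 \<noteq> 0" "h t0 \<noteq> 0"
  proof (cases "t1 = 0")
    case True
    have "\<forall>\<^sub>F t in at t1. h t \<noteq> 0" using conth t1 by (rule tendsto_imp_eventually_ne)
    moreover have "\<forall>\<^sub>F t in at t1. t \<noteq> t1" by (rule eventually_neq_at_within)
    ultimately have "\<exists>t. h t \<noteq> 0 \<and> t \<noteq> t1"
      by (intro eventually_happens'[OF at_neq_bot[of t1]]) (rule eventually_conj)
    then show ?thesis using that True by blast
  qed (use t1 that in blast)
  \<comment> \<open>The curve on the ray with its weights divided out:
    \<open>\<delta> (\<rho> t0)\<close> is \<open>scal\<close> of the vector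
    \<open>\<rho> ^ a\<close> applied to \<open>w \<rho>\<close>, and \<open>w \<rho>\<close> tends
    to \<open>w0\<close>.\<close>
  define w where "w \<rho> = (\<chi> j. \<delta> (of_real \<rho> * t0) $ j / of_real \<rho> ^ a j)" for \<rho> :: real
  define w0 where "w0 = (\<chi> j. c $ j * t0 ^ a j)"
  have ray: "filterlim (\<lambda>\<rho>. complex_of_real \<rho> * t0) (at 0) (at_right 0)"
    unfolding filterlim_at
  proof
    show "((\<lambda>\<rho>. complex_of_real \<rho> * t0) \<longlongrightarrow> 0) (at_right 0)"
      by (auto intro!: tendsto_eq_intros)
    show "\<forall>\<^sub>F \<rho> in at_right 0. complex_of_real \<rho> * t0 \<in> UNIV \<and> complex_of_real \<rho> * t0 \<noteq> 0"
      using eventually_at_right_less[of "0::real"] by eventually_elim (use t0 in auto)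
  qed
  have w: "(w \<longlongrightarrow> w0) (at_right 0)"
  proof (rule vec_tendstoI)
    fix j
    have "((\<lambda>\<rho>. \<delta> (of_real \<rho> * t0) $ j / (of_real \<rho> * t0) ^ a j * t0 ^ a j) \<longlongrightarrow> c $ j * t0 ^ a j) (at_right 0)"
      by (intro tendsto_intros filterlim_compose[OF lim ray])
    moreover have "\<delta> (of_real \<rho> * t0) $ j / (of_real \<rho> * t0) ^ a j * t0 ^ a j = w \<rho> $ j" for \<rho>
      using t0 by (simp add: w_def power_mult_distrib)
    ultimately show "((\<lambda>\<rho>. w \<rho> $ j) \<longlongrightarrow> w0 $ j) (at_right 0)" by (simp add: w0_def)
  qed
  have "continuous_on UNIV (\<lambda>z. G z)" by (rule contG)
  then have "((\<lambda>\<rho>. G (w \<rho>)) \<longlongrightarrow> G w0) (at_right 0)"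
    by (intro isCont_tendsto_compose[OF _ w]) (simp add: continuous_on_eq_continuous_at)
  then have Glim: "((\<lambda>\<rho>. \<bar>G (w \<rho>)\<bar>) \<longlongrightarrow> \<bar>G w0\<bar>) (at_right 0)" by (rule tendsto_rabs)
  obtain C where C: "\<forall>\<^sub>F \<rho> in at_right 0. \<forall>z\<in>cball 0 (norm w0 + 1).
    \<bar>F (scal (\<chi> j. \<rho> ^ a j) z) - \<rho> ^ l * G z\<bar> \<le> C * \<rho> ^ Suc l"
    using weighted_expansion[OF W, of a l "norm w0 + 1"] a l unfolding G_def by blast
  obtain B where "\<forall>\<^sub>F t in at 0. norm (norm (F (\<delta> t))) \<le> B * norm (norm t ^ Suc l)"
    using bigo by (auto elim: landau_o.bigE)
  then have B: "\<forall>\<^sub>F \<rho> in at_right 0. norm (norm (F (\<delta> (of_real \<rho> * t0)))) \<le> B * norm (norm (of_real \<rho> * t0) ^ Suc l)"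
    by (rule eventually_compose_filterlim[OF _ ray])
  have "\<forall>\<^sub>F \<rho> in at_right 0. norm (w \<rho>) < norm w0 + 1"
    by (rule order_tendstoD(2)[OF tendsto_norm[OF w]]) simp
  with B C eventually_at_right_less[of "0::real"]
  \<comment> \<open>The expansion and the assumed order \<open>Suc l\<close> both leave a factor
    \<open>\<rho>\<close> after division by \<open>\<rho> ^ l\<close>, so the limit of
    \<open>G (w \<rho>)\<close> must vanish, against the choice of \<open>t0\<close>.\<close>
  have le: "\<forall>\<^sub>F \<rho> in at_right 0. \<bar>G (w \<rho>)\<bar> \<le> (C + B * norm t0 ^ Suc l) * \<rho>"
  proof eventually_elim
    case (elim \<rho>)
    have scal: "scal (\<chi> j. \<rho> ^ a j) (w \<rho>) = \<delta> (of_real \<rho> * t0)"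
      using elim by (simp add: vec_eq_iff w_def)
    have "\<rho> ^ l * \<bar>G (w \<rho>)\<bar> = \<bar>\<rho> ^ l * G (w \<rho>)\<bar>" using elim by (simp add: abs_mult)
    also have "\<dots> \<le> C * \<rho> ^ Suc l + \<bar>F (\<delta> (of_real \<rho> * t0))\<bar>"
      using elim(2)[rule_format, of "w \<rho>"] elim(4) unfolding scal by (simp add: abs_le_iff) linarith
    also have "\<dots> \<le> C * \<rho> ^ Suc l + B * (\<rho> * norm t0) ^ Suc l"
      using elim(1,3) by (simp add: norm_mult)
    also have "\<dots> = \<rho> ^ l * ((C + B * norm t0 ^ Suc l) * \<rho>)"
      by (simp add: power_mult_distrib algebra_simps)
    finally show ?case using elim by simp
  qed
  have "((\<lambda>\<rho>. (C + B * norm t0 ^ Suc l) * \<rho>) \<longlongrightarrow> 0) (at_right 0)"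
    by (auto intro!: tendsto_eq_intros)
  then have "\<bar>G w0\<bar> \<le> 0"
    by (rule tendsto_le[OF trivial_limit_at_right_real _ Glim le])
  then show False using t0 by (simp add: h_def w0_def)
qed

text \<open>\<open>M j\<close> is a support point on axis \<open>j\<close>, so the least weight is
  at most \<open>a j * M j j\<close> for every \<open>j\<close>. Summing the \<open>M j j\<close>
  gives a constant that does not see the curve.\<close>

lemma convenient_type_bound:
  fixes F :: "complex^'n::finite \<Rightarrow> real"
  assumes W: "smooth_on W F" "open W" "0 \<in> W" and nd: "N_nondegenerate F" and "convenient F"
  shows "\<exists>K. \<forall>\<delta> c a. (\<forall>j. a j > 0 \<and> c $ j \<noteq> 0 \<and> ((\<lambda>t. \<delta> t $ j / t ^ a j) \<longlongrightarrow> c $ j) (at 0)) \<longrightarrow>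
    (\<exists>l. (\<forall>j. l \<le> K * a j) \<and> (\<lambda>t. norm (F (\<delta> t))) \<notin> O[at 0](\<lambda>t. norm t ^ Suc l))"
proof -
  obtain M where M: "\<And>j. M j \<in> supp_S F" "\<And>i j. i \<noteq> j \<Longrightarrow> M j i = 0"
    using assms(5) unfolding convenient_iff by metis
  show ?thesis
  proof (rule exI[of _ "\<Sum>j\<in>UNIV. M j j"], intro allI impI)
    fix \<delta> :: "complex \<Rightarrow> complex^'n" and c a
    assume *: "\<forall>j. a j > 0 \<and> c $ j \<noteq> 0 \<and> ((\<lambda>t. \<delta> t $ j / t ^ a j) \<longlongrightarrow> c $ j) (at 0)"
    \<comment> \<open>\<open>M undefined\<close> only witnesses that the support is
      nonempty.\<close>
    obtain m0 where m0: "m0 \<in> supp_S F" "\<And>m. m \<in> supp_S F \<Longrightarrow> weight a m0 \<le> weight a m"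
      using ex_has_least_nat[of "\<lambda>m. m \<in> supp_S F" "M undefined" "weight a"] M(1) by blast
    have "weight a m0 \<le> (\<Sum>j\<in>UNIV. M j j) * a j" for j
    proof -
      have "weight a m0 \<le> weight a (M j)" by (rule m0(2)[OF M(1)])
      also have "\<dots> = (\<Sum>i\<in>{j}. a i * M j i)"
        unfolding weight_def by (rule sum.mono_neutral_right) (auto simp: M(2))
      also have "\<dots> \<le> (\<Sum>j\<in>UNIV. M j j) * a j"
        using member_le_sum[of j UNIV "\<lambda>j. M j j"] by simp
      finally show ?thesis .
    qed
    moreover have "(\<lambda>t. norm (F (\<delta> t))) \<notin> O[at 0](\<lambda>t. norm t ^ Suc (weight a m0))"
      by (rule not_bigo_weight[OF W nd _ m0(1) refl m0(2)]) (use * in auto)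
    ultimately show "\<exists>l. (\<forall>j. l \<le> (\<Sum>j\<in>UNIV. M j j) * a j) \<and> (\<lambda>t. norm (F (\<delta> t))) \<notin> O[at 0](\<lambda>t. norm t ^ Suc l)"
      by blast
  qed
qed

lemma norm_axis_eq: "norm (axis j x) = norm x"
proof -
  have "(norm (axis j x $ i))\<^sup>2 = (if i = j then (norm x)\<^sup>2 else 0)" for i
    by (simp add: axis_def)
  then show ?thesis by (simp add: norm_vec_def L2_set_def)
qed

text \<open>Each support point has a positive entry off axis \<open>j\<close>, so every Taylor
  polynomial vanishes on that axis and \<open>F\<close> equals its remainder there.\<close>

lemma not_convenient_axis:
  fixes F :: "complex^'n::finite \<Rightarrow> real"
  assumes W: "smooth_on W F" "open W" "0 \<in> W" and "\<not> convenient F"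
  shows "\<exists>j. \<forall>N. (\<lambda>t. F (axis j t)) \<in> O[at 0](\<lambda>t. norm t ^ N)"
proof -
  obtain j where j: "\<And>m. m \<in> supp_S F \<Longrightarrow> \<exists>i. i \<noteq> j \<and> m i \<noteq> 0"
    using assms(4) unfolding convenient_iff by blast
  have "(\<lambda>t. F (axis j t)) \<in> O[at 0](\<lambda>t. norm t ^ N)" for N
  proof -
    obtain \<delta> C where \<delta>: "\<delta> > 0" and C: "\<And>z s. z \<in> cball 0 1 \<Longrightarrow> s \<in> cball 0 \<delta> \<Longrightarrow>
      \<bar>F (scal s z) - (\<Sum>m\<in>multi_box N UNIV. (\<Prod>i\<in>UNIV. (s $ i) ^ m i) * taylor_part F m z)\<bar> \<le> C * norm s ^ N"
      using taylor_scal[OF W, of 1 N] by blast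
    have "norm (F (axis j t)) \<le> C * norm (norm t ^ N)" if t: "norm t \<le> \<delta>" "t \<noteq> 0" for t
    proof -
      \<comment> \<open>Polar form of \<open>t\<close>: the modulus is the scale and the phase a
        unit vector, so one expansion over the unit ball serves all directions of
        \<open>t\<close>.\<close>
      define s :: "real^'n" where "s = axis j (norm t)"
      define z :: "complex^'n" where "z = axis j (sgn t)"
      have zero: "(\<Prod>i\<in>UNIV. (s $ i) ^ m i) * taylor_part F m z = 0" for m
      proof (cases "m \<in> supp_S F")
        case True
        then obtain i where "i \<noteq> j" "m i \<noteq> 0" using j by blast
        then show ?thesis by (auto simp: s_def axis_def intro!: bexI[of _ i])
      qed (auto simp: supp_S_def)
      have "(\<Sum>m\<in>multi_box N UNIV. (\<Prod>i\<in>UNIV. (s $ i) ^ m i) * taylor_part F m z) = 0"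
        by (simp only: zero sum.neutral_const)
      moreover have "scal s z = axis j t"
        by (auto simp: vec_eq_iff s_def z_def axis_def sgn_div_norm scaleR_conv_of_real t)
      moreover have "norm s = norm t" "norm z = 1"
        using t by (simp_all add: s_def z_def norm_axis_eq norm_sgn)
      ultimately show ?thesis using C[of z s] t by simp
    qed
    then show ?thesis
      by (intro bigoI[of _ C]) (use \<delta> in \<open>auto simp: eventually_at intro!: exI[of _ \<delta>]\<close>)
  qed
  then show ?thesis by blast
qed

section \<open>Comparison of defining functions\<close>

lemma norm_cscale: "norm (c *s v) = norm c * norm (v :: complex^'n)"
  by (simp add: norm_vec_def norm_mult L2_set_right_distrib)

text \<open>Complex linearity of \<open>L\<close> is what turns the real chain rule into a complex
  derivative, since then \<open>L (h *s g') = h *s L g'\<close>.\<close>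

lemma holo_map_comp_nth:
  fixes \<Phi> :: "complex^'n::finite \<Rightarrow> complex^'m::finite"
  assumes L: "(\<Phi> has_derivative L) (at (g t))" "\<And>(c::complex) w. L (c *s w) = c *s L w"
    and g: "\<And>i. ((\<lambda>t. g t $ i) has_field_derivative g' $ i) (at t)"
  shows "((\<lambda>t. \<Phi> (g t) $ j) has_field_derivative L g' $ j) (at t)"
proof -
  have "(g has_derivative (\<lambda>h. h *s g')) (at t)"
  proof (rule has_derivative_componentwise_within[THEN iffD2], rule ballI)
    fix u :: "complex^'n" assume "u \<in> Basis"
    then obtain i b where u: "u = axis i b" by (auto simp: Basis_vec_def)
    have "((\<lambda>t. g t $ i) has_derivative (\<lambda>h. h * g' $ i)) (at t)"
      using g[of i] by (simp add: has_field_derivative_def mult_commute_abs)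
    then have "((\<lambda>t. g t $ i \<bullet> b) has_derivative (\<lambda>h. (h * g' $ i) \<bullet> b)) (at t)"
      by (rule has_derivative_inner_left)
    then show "((\<lambda>t. g t \<bullet> u) has_derivative (\<lambda>h. (h *s g') \<bullet> u)) (at t)"
      by (simp add: u inner_axis)
  qed
  from has_derivative_compose[OF this L(1)]
  have "((\<lambda>t. \<Phi> (g t)) has_derivative (\<lambda>h. h *s L g')) (at t)" by (simp add: L(2))
  then have "((\<lambda>t. \<Phi> (g t) $ j) has_derivative (\<lambda>h. (h *s L g') $ j)) (at t)"
    by (rule bounded_linear.has_derivative[OF bounded_linear_vec_nth])
  then show ?thesis
    by (simp add: has_field_derivative_def mult_commute_abs)
qed

lemma holo_map_continuous:
  assumes "holo_map_on U \<Phi>"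
  shows "continuous_on U \<Phi>"
proof (rule continuous_at_imp_continuous_on, rule ballI)
  fix z assume "z \<in> U"
  then show "isCont \<Phi> z"
    using assms has_derivative_continuous unfolding holo_map_on_def by blast
qed

text \<open>Holomorphy is only assumed pointwise here, so a local bound for the derivative comes from
  Cauchy's inequality on complex lines.\<close>

lemma holo_map_lipschitz:
  fixes \<Phi> :: "complex^'n::finite \<Rightarrow> complex^'m::finite"
  assumes hol: "holo_map_on U \<Phi>" and "open U" "p \<in> U"
  obtains \<rho> C where "\<rho> > 0" "ball p \<rho> \<subseteq> U"
    "\<And>x y. x \<in> ball p \<rho> \<Longrightarrow> y \<in> ball p \<rho> \<Longrightarrow> norm (\<Phi> x - \<Phi> y) \<le> C * norm (x - y)"
proof -
  obtain e where e: "e > 0" "cball p e \<subseteq> U"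
    using assms(2,3) by (meson open_contains_cball)
  \<comment> \<open>Half the radius, so that complex discs of radius \<open>\<rho>\<close> centred
    in \<open>ball p \<rho>\<close> stay inside \<open>cball p e\<close>, where \<open>B\<close>
    bounds the map.\<close>
  define \<rho> where "\<rho> = e / 2"
  have \<rho>: "\<rho> > 0" using e by (simp add: \<rho>_def)
  have "compact (\<Phi> ` cball p e)"
    by (intro compact_continuous_image compact_cball continuous_on_subset[OF holo_map_continuous[OF hol]] e)
  from compact_imp_bounded[OF this, unfolded bounded_iff]
  obtain B where B: "\<forall>x\<in>\<Phi> ` cball p e. norm x \<le> B" ..
  have "norm (\<Phi> p) \<le> B" using B e(1) by auto
  then have "B \<ge> 0" by (rule order_trans[OF norm_ge_zero])
  have in_U: "z + \<zeta> *s v \<in> cball p e" if "z \<in> ball p \<rho>" "norm v = 1" "norm \<zeta> \<le> \<rho>" for z v \<zeta>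
  proof -
    have "dist p (z + \<zeta> *s v) \<le> dist p z + dist z (z + \<zeta> *s v)" by (rule dist_triangle)
    also have "dist z (z + \<zeta> *s v) = norm \<zeta>" using that by (simp add: dist_norm norm_cscale)
    finally show ?thesis using that by (simp add: \<rho>_def)
  qed
  \<comment> \<open>Cauchy's bound \<open>B / \<rho>\<close>, once for each component.\<close>
  define C where "C = real CARD('m) * (B / \<rho>)"
  have bound: "norm (L v) \<le> C" if z: "z \<in> ball p \<rho>" and v: "norm v = 1"
    and L: "(\<Phi> has_derivative L) (at z)" "\<And>(c::complex) w. L (c *s w) = c *s L w" for z v L
  proof -
    have comp: "norm (L v $ j) \<le> B / \<rho>" for j
    proof -
      define h where "h \<zeta> = \<Phi> (z + \<zeta> *s v) $ j" for \<zeta>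
      have lin: "((\<lambda>\<zeta>. (z + \<zeta> *s v) $ i) has_field_derivative v $ i) (at \<zeta>)" for \<zeta> i
        by (auto intro!: derivative_eq_intros)
      have dh: "\<exists>D. (h has_field_derivative D) (at \<zeta>)" if n: "norm \<zeta> \<le> \<rho>" for \<zeta>
      proof -
        obtain L' where "(\<Phi> has_derivative L') (at (z + \<zeta> *s v))" "\<And>(c::complex) w. L' (c *s w) = c *s L' w"
          using hol in_U[OF z v n] e(2) unfolding holo_map_on_def by blast
        from holo_map_comp_nth[where g = "\<lambda>\<zeta>. z + \<zeta> *s v", OF this lin]
        show ?thesis unfolding h_def by blast
      qed
      have "norm ((deriv ^^ 1) h 0) \<le> fact 1 * B / \<rho> ^ 1"
      proof (rule Cauchy_inequality)
        show "h holomorphic_on ball 0 \<rho>"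
          unfolding holomorphic_on_def field_differentiable_def
        proof
          fix \<zeta> :: complex assume "\<zeta> \<in> ball 0 \<rho>"
          then obtain D where "(h has_field_derivative D) (at \<zeta>)" using dh[of \<zeta>] by auto
          then show "\<exists>D. (h has_field_derivative D) (at \<zeta> within ball 0 \<rho>)"
            using has_field_derivative_at_within by blast
        qed
        show "continuous_on (cball 0 \<rho>) h"
        proof (rule continuous_at_imp_continuous_on, rule ballI)
          fix \<zeta> :: complex assume "\<zeta> \<in> cball 0 \<rho>"
          then obtain D where "(h has_field_derivative D) (at \<zeta>)" using dh[of \<zeta>] by auto
          then show "isCont h \<zeta>" by (rule DERIV_isCont)
        qed
        fix x :: complex assume "norm (0 - x) = \<rho>"
        then have "norm (\<Phi> (z + x *s v)) \<le> B" using in_U[OF z v, of x] B by auto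
        then show "norm (h x) \<le> B"
          unfolding h_def using order_trans Finite_Cartesian_Product.norm_nth_le by metis
      qed (rule \<rho>)
      moreover have "(h has_field_derivative L v $ j) (at 0)"
        unfolding h_def
        by (rule holo_map_comp_nth[where g = "\<lambda>\<zeta>. z + \<zeta> *s v", OF _ L(2) lin]) (simp add: L(1))
      ultimately show ?thesis by (simp add: DERIV_imp_deriv)
    qed
    have "norm (L v) \<le> (\<Sum>j\<in>UNIV. norm (L v $ j))"
      unfolding norm_vec_def by (rule L2_set_le_sum) simp
    also have "\<dots> \<le> (\<Sum>j\<in>(UNIV::'m set). B / \<rho>)" by (intro sum_mono comp)
    finally show ?thesis by (simp add: C_def)
  qed
  define D where "D z = (SOME L. (\<Phi> has_derivative L) (at z) \<and> (\<forall>(c::complex) w. L (c *s w) = c *s L w))" for z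
  have sub: "ball p \<rho> \<subseteq> U" using e(2) e(1) by (auto simp: \<rho>_def subset_iff)
  have D: "(\<Phi> has_derivative D z) (at z)" "D z (c *s w) = c *s D z w" if "z \<in> ball p \<rho>" for z w and c :: complex
  proof -
    have "\<exists>L. (\<Phi> has_derivative L) (at z) \<and> (\<forall>(c::complex) w. L (c *s w) = c *s L w)"
      using hol sub that unfolding holo_map_on_def by blast
    from someI_ex[OF this] show "(\<Phi> has_derivative D z) (at z)" "D z (c *s w) = c *s D z w"
      unfolding D_def by auto
  qed
  have "norm (\<Phi> x - \<Phi> y) \<le> C * norm (x - y)" if xy: "x \<in> ball p \<rho>" "y \<in> ball p \<rho>" for x y
  proof (rule differentiable_bound[OF convex_ball _ _ xy])
    fix z assume z: "z \<in> ball p \<rho>"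
    show "(\<Phi> has_derivative D z) (at z within ball p \<rho>)"
      by (rule has_derivative_at_withinI[OF D(1)[OF z]])
    interpret D: bounded_linear "D z" using D(1)[OF z] by (rule has_derivative_bounded_linear)
    show "onorm (D z) \<le> C"
    proof (rule onorm_bound)
      show "0 \<le> C" using \<open>B \<ge> 0\<close> \<rho> by (simp add: C_def)
      fix v
      show "norm (D z v) \<le> C * norm v"
      proof (cases "v = 0")
        case False
        have "norm (D z (v /\<^sub>R norm v)) \<le> C"
          by (rule bound[OF z _ D(1)[OF z] D(2)[OF z]]) (use False in simp)
        then show ?thesis using False by (simp add: D.scaleR field_simps)
      qed (simp add: D.zero)
    qed
  qed
  then show thesis by (rule that[OF \<rho> sub])
qed

text \<open>For smooth functions the continuous first partial derivatives bound the derivative on a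
  compact ball directly.\<close>

lemma smooth_lipschitz:
  assumes sm: "smooth_on W f" and "open W" "p \<in> W"
  obtains \<rho> C where "\<rho> > 0" "ball p \<rho> \<subseteq> W"
    "\<And>x y. x \<in> ball p \<rho> \<Longrightarrow> y \<in> ball p \<rho> \<Longrightarrow> \<bar>f x - f y\<bar> \<le> C * norm (x - y)"
proof -
  obtain \<rho> where \<rho>: "\<rho> > 0" "cball p \<rho> \<subseteq> W"
    using assms(2,3) by (meson open_contains_cball)
  have sub: "ball p \<rho> \<subseteq> W" using \<rho>(2) ball_subset_cball by blast
  have "compact ((\<lambda>x. \<Sum>b\<in>Basis. \<bar>dderivs [b] f x\<bar>) ` cball p \<rho>)"
    by (intro compact_continuous_image compact_cball continuous_intros
        continuous_on_subset[OF smooth_on_continuous[OF sm] \<rho>(2)]) auto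
  from compact_imp_bounded[OF this, unfolded bounded_iff]
  obtain C where "\<forall>x\<in>(\<lambda>x. \<Sum>b\<in>Basis. \<bar>dderivs [b] f x\<bar>) ` cball p \<rho>. norm x \<le> C" ..
  then have C: "(\<Sum>b\<in>Basis. \<bar>dderivs [b] f x\<bar>) \<le> C" if "x \<in> cball p \<rho>" for x
    using that by (auto dest!: bspec[of _ _ x])
  have "C \<ge> 0" using order_trans[OF sum_nonneg C[of p]] \<rho>(1) by auto
  have "norm (f x - f y) \<le> C * norm (x - y)" if "x \<in> ball p \<rho>" "y \<in> ball p \<rho>" for x y
  proof (rule differentiable_bound[OF convex_ball _ _ that])
    fix z assume z: "z \<in> ball p \<rho>"
    let ?D = "frechet_derivative f (at z)"
    have D: "(f has_derivative ?D) (at z)"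
      using smooth_on_differentiable[OF sm assms(2), of z "[]"] z sub by (auto simp: frechet_derivative_works)
    then show "(f has_derivative ?D) (at z within ball p \<rho>)"
      by (rule has_derivative_at_withinI)
    interpret D: bounded_linear ?D using D by (rule has_derivative_bounded_linear)
    show "onorm ?D \<le> C"
    proof (rule onorm_bound[OF \<open>C \<ge> 0\<close>])
      fix v
      have "?D v = ?D (\<Sum>b\<in>Basis. (v \<bullet> b) *\<^sub>R b)" by (simp add: euclidean_representation)
      also have "\<dots> = (\<Sum>b\<in>Basis. (v \<bullet> b) * ?D b)" by (simp add: D.sum D.scaleR)
      also have "norm \<dots> \<le> (\<Sum>b\<in>Basis. norm v * \<bar>?D b\<bar>)"
        by (rule order_trans[OF norm_sum], rule sum_mono)
          (auto simp: abs_mult intro!: mult_right_mono Basis_le_norm)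
      also have "\<dots> = norm v * (\<Sum>b\<in>Basis. \<bar>dderivs [b] f z\<bar>)"
        by (simp add: sum_distrib_left dderiv_eq[OF D])
      also have "\<dots> \<le> norm v * C" using C[of z] z by (intro mult_left_mono) auto
      finally show "norm (?D v) \<le> C * norm v" by (simp add: mult.commute)
    qed
  qed
  then show thesis unfolding real_norm_def by (rule that[OF \<rho>(1) sub])
qed

text \<open>Moving from \<open>z\<close> in a direction in which \<open>f\<close> has positive derivative reaches a zero of \<open>f\<close>
  at distance \<open>O(\<bar>f z\<bar>)\<close>, where \<open>g\<close> vanishes as well.\<close>

lemma defining_function_dominates:
  fixes f g :: "'a::euclidean_space \<Rightarrow> real"
  assumes sm: "smooth_on W f" and W: "open W" "p \<in> W" and "f p = 0"
    and grad: "frechet_derivative f (at p) \<noteq> (\<lambda>v. 0)"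
    and \<rho>: "\<rho> > 0" and lip: "\<And>x y. x \<in> ball p \<rho> \<Longrightarrow> y \<in> ball p \<rho> \<Longrightarrow> \<bar>g x - g y\<bar> \<le> C * norm (x - y)"
    and zero: "\<And>z. z \<in> ball p \<rho> \<Longrightarrow> f z = 0 \<Longrightarrow> g z = 0"
  shows "\<exists>C. \<forall>\<^sub>F z in nhds p. \<bar>g z\<bar> \<le> C * \<bar>f z\<bar>"
proof -
  have D: "(f has_derivative frechet_derivative f (at z)) (at z)" if "z \<in> W" for z
    using smooth_on_differentiable[OF sm W(1) that, of "[]"] by (simp add: frechet_derivative_works)
  interpret Dp: bounded_linear "frechet_derivative f (at p)"
    using D[OF W(2)] by (rule has_derivative_bounded_linear)
  \<comment> \<open>A basis direction is chosen because \<open>smooth_on\<close> gives continuity of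
    the partial derivatives along \<open>Basis\<close>.\<close>
  obtain b where b: "b \<in> Basis" "frechet_derivative f (at p) b \<noteq> 0"
  proof (rule ccontr)
    assume "\<not> thesis"
    then have "\<And>b. b \<in> Basis \<Longrightarrow> frechet_derivative f (at p) b = 0" using that by blast
    then have "frechet_derivative f (at p) v = 0" for v
      using Dp.sum[of "\<lambda>b. (v \<bullet> b) *\<^sub>R b" Basis] by (simp add: euclidean_representation Dp.scaleR)
    then show False using grad by auto
  qed
  \<comment> \<open>The sign orients \<open>v\<close> so that \<open>d p\<close> is positive; half
    of it, \<open>k\<close> below, is then a lower bound for \<open>d\<close> near
    \<open>p\<close>.\<close>
  define \<sigma> where "\<sigma> = sgn (frechet_derivative f (at p) b)"
  define v where "v = \<sigma> *\<^sub>R b"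
  define d where "d z = \<sigma> * dderivs [b] f z" for z
  have nv: "norm v = 1" using b by (simp add: v_def \<sigma>_def abs_sgn_eq)
  have d: "frechet_derivative f (at z) v = d z" if "z \<in> W" for z
  proof -
    interpret D: bounded_linear "frechet_derivative f (at z)"
      using D[OF that] by (rule has_derivative_bounded_linear)
    show ?thesis by (simp add: v_def d_def D.scaleR dderiv_eq[OF D[OF that]])
  qed
  define k where "k = d p / 2"
  have k: "k > 0"
    using b by (simp add: k_def d_def \<sigma>_def dderiv_eq[OF D[OF W(2)]] sgn_mult_self_eq mult_sgn_abs sgn_if)
  have "continuous_on W d"
    unfolding d_def by (intro continuous_intros smooth_on_continuous[OF sm]) (use b in auto)
  then have "isCont d p" using W by (simp add: continuous_on_eq_continuous_at)
  then have "(d \<longlongrightarrow> d p) (nhds p)" by (simp add: isCont_def tendsto_at_iff_tendsto_nhds)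
  moreover have "k < d p" using k by (simp add: k_def)
  ultimately have "\<forall>\<^sub>F z in nhds p. k < d z" by (rule order_tendstoD)
  moreover have "\<forall>\<^sub>F z in nhds p. z \<in> W \<inter> ball p \<rho>"
    using W \<rho> by (intro eventually_nhds_in_open) auto
  ultimately have "\<forall>\<^sub>F z in nhds p. k < d z \<and> z \<in> W \<inter> ball p \<rho>" by (rule eventually_conj)
  then obtain \<eta> where \<eta>: "\<eta> > 0" "\<And>z. dist z p < \<eta> \<Longrightarrow> k < d z \<and> z \<in> W \<inter> ball p \<rho>"
    unfolding eventually_nhds_metric by blast
  have "isCont f p" using D[OF W(2)] by (rule has_derivative_continuous)
  then have "(f \<longlongrightarrow> f p) (nhds p)"
    by (simp add: isCont_def tendsto_at_iff_tendsto_nhds)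
  from tendsto_rabs[OF this] have "((\<lambda>z. \<bar>f z\<bar>) \<longlongrightarrow> 0) (nhds p)"
    using \<open>f p = 0\<close> by simp
  then have small: "\<forall>\<^sub>F z in nhds p. \<bar>f z\<bar> < k * \<eta> / 2"
    using k \<eta>(1) by (intro order_tendstoD(2)) auto
  have near: "\<forall>\<^sub>F z in nhds p. dist z p < \<eta> / 2"
    unfolding eventually_nhds_metric using \<eta>(1) by (intro exI[of _ "\<eta> / 2"]) auto
  from small near have "\<forall>\<^sub>F z in nhds p. \<bar>g z\<bar> \<le> \<bar>C\<bar> / k * \<bar>f z\<bar>"
  proof eventually_elim
    case (elim z)
    \<comment> \<open>With slope at least \<open>k\<close>, a step of length \<open>e\<close>
      changes \<open>f\<close> by at least \<open>\<bar>f z\<bar>\<close>, so a zero lies between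
      \<open>-e\<close> and \<open>e\<close>. The bound on \<open>\<bar>f z\<bar>\<close> makes
      \<open>e < \<eta> / 2\<close>, which keeps the segment where the slope estimate holds.\<close>
    define e where "e = \<bar>f z\<bar> / k"
    have e: "0 \<le> e" "e < \<eta> / 2" using elim k by (auto simp: e_def field_simps)
    define \<phi> where "\<phi> \<tau> = f (z + \<tau> *\<^sub>R v)" for \<tau>
    have close: "dist (z + \<tau> *\<^sub>R v) p < \<eta>" if "\<bar>\<tau>\<bar> \<le> e" for \<tau>
    proof -
      have "dist (z + \<tau> *\<^sub>R v) p \<le> dist (z + \<tau> *\<^sub>R v) z + dist z p" by (rule dist_triangle)
      also have "dist (z + \<tau> *\<^sub>R v) z = \<bar>\<tau>\<bar>" using nv by (simp add: dist_norm)
      finally show ?thesis using that e elim by simp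
    qed
    have deriv: "(\<phi> has_real_derivative d (z + \<tau> *\<^sub>R v)) (at \<tau>)" if "\<bar>\<tau>\<bar> \<le> e" for \<tau>
    proof -
      let ?L = "frechet_derivative f (at (z + \<tau> *\<^sub>R v))"
      have zW: "z + \<tau> *\<^sub>R v \<in> W" using \<eta>(2)[OF close[OF that]] by blast
      interpret L: bounded_linear ?L using D[OF zW] by (rule has_derivative_bounded_linear)
      have "((\<lambda>\<tau>. z + \<tau> *\<^sub>R v) has_derivative (\<lambda>h. h *\<^sub>R v)) (at \<tau>)"
        by (auto intro!: derivative_eq_intros)
      from has_derivative_compose[OF this D[OF zW]]
      have "(\<phi> has_derivative (\<lambda>h. ?L (h *\<^sub>R v))) (at \<tau>)" unfolding \<phi>_def .
      then show ?thesis
        using d[OF zW] by (simp add: has_field_derivative_def L.scaleR mult_commute_abs)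
    qed
    have cont: "continuous_on {-e..e} \<phi>"
      by (intro continuous_at_imp_continuous_on ballI DERIV_isCont[OF deriv]) auto
    have grow: "\<phi> y - \<phi> x \<ge> k * (y - x)" if "x \<le> y" "-e \<le> x" "y \<le> e" for x y
    proof (cases "x = y")
      case False
      then have "\<exists>\<tau>>x. \<tau> < y \<and> \<phi> y - \<phi> x = (y - x) * d (z + \<tau> *\<^sub>R v)"
        using that by (intro MVT2 deriv) auto
      then obtain \<tau> where \<tau>: "x < \<tau>" "\<tau> < y" "\<phi> y - \<phi> x = (y - x) * d (z + \<tau> *\<^sub>R v)"
        by blast
      have "d (z + \<tau> *\<^sub>R v) > k" using \<eta>(2)[OF close[of \<tau>]] \<tau> that by auto
      then have "(y - x) * k \<le> (y - x) * d (z + \<tau> *\<^sub>R v)" using that by (intro mult_left_mono) auto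
      then show ?thesis using \<tau>(3) by (simp add: mult.commute)
    qed simp
    have ke: "k * e = \<bar>f z\<bar>" using k by (simp add: e_def)
    have "\<phi> (-e) \<le> 0" "0 \<le> \<phi> e"
      using grow[of "-e" 0] grow[of 0 e] e(1) ke by (auto simp: \<phi>_def)
    then obtain \<tau> where \<tau>: "-e \<le> \<tau>" "\<tau> \<le> e" "\<phi> \<tau> = 0"
      using IVT'[of \<phi> "-e" 0 e] cont e(1) by auto
    have zt: "z + \<tau> *\<^sub>R v \<in> ball p \<rho>" using \<eta>(2)[OF close[of \<tau>]] \<tau> by auto
    have z: "z \<in> ball p \<rho>" using \<eta>(2)[of z] elim \<eta>(1) by auto
    have "g (z + \<tau> *\<^sub>R v) = 0" using zero[OF zt] \<tau>(3) by (simp add: \<phi>_def)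
    then have "\<bar>g z\<bar> \<le> C * \<bar>\<tau>\<bar>" using lip[OF z zt] nv by simp
    also have "\<dots> \<le> \<bar>C\<bar> * e" using \<tau> by (intro mult_mono) auto
    finally show ?case by (simp add: e_def)
  qed
  then show ?thesis by blast
qed

section \<open>Orders of vanishing and their behaviour under a change of coordinates\<close>

lemma bigo_power_mono:
  assumes "k \<le> n"
  shows "(\<lambda>t::complex. norm t ^ n) \<in> O[at 0](\<lambda>t. norm t ^ k)"
proof (rule bigoI[of _ 1])
  have "\<forall>\<^sub>F t::complex in at 0. norm t < 1"
    by (auto simp: eventually_at intro!: exI[of _ 1])
  then show "\<forall>\<^sub>F t::complex in at 0. norm (norm t ^ n) \<le> 1 * norm (norm t ^ k)"
    by eventually_elim (use assms in \<open>auto intro!: power_decreasing\<close>)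
qed

lemma vanish_ord_ge:
  assumes "(\<lambda>t. norm (h t)) \<in> O[at 0](\<lambda>t. norm t ^ k)"
  shows "enat k \<le> vanish_ord h"
  unfolding vanish_ord_def by (rule Sup_upper) (use assms in blast)

lemma vanish_ord_le:
  assumes "(\<lambda>t. norm (h t)) \<notin> O[at 0](\<lambda>t. norm t ^ Suc l)"
  shows "vanish_ord h \<le> enat l"
  unfolding vanish_ord_def
proof (rule Sup_least)
  fix x assume "x \<in> {enat k |k. (\<lambda>t. norm (h t)) \<in> O[at 0](\<lambda>t. norm t ^ k)}"
  then obtain k where k: "x = enat k" "(\<lambda>t. norm (h t)) \<in> O[at 0](\<lambda>t. norm t ^ k)" by blast
  have "\<not> Suc l \<le> k"
    using landau_o.big_trans[OF k(2) bigo_power_mono] assms by blast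
  then show "x \<le> enat l" using k(1) by simp
qed

lemma inf_tangent_vanish_ord:
  assumes "inf_tangent r \<gamma>"
  shows "vanish_ord (r \<circ> \<gamma>) = \<infinity>"
proof -
  have "enat k \<le> vanish_ord (r \<circ> \<gamma>)" for k
    by (rule vanish_ord_ge) (use assms in \<open>simp add: inf_tangent_def\<close>)
  then show ?thesis by (metis enat_ord_simps(1) not_enat_eq Suc_n_not_le_n)
qed

text \<open>\<open>defining_function_dominates\<close> asks of its second function just a Lipschitz
  bound and the right zeros, so this is all that has to be known about the composite.\<close>

lemma holo_smooth_lipschitz:
  fixes \<Phi> :: "complex^'n::finite \<Rightarrow> complex^'m::finite"
  assumes hol: "holo_map_on U \<Phi>" "open U" "p \<in> U" and sm: "smooth_on W f" "open W" "\<Phi> p \<in> W"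
  obtains \<rho> C where "\<rho> > 0" "ball p \<rho> \<subseteq> U" "\<And>x. x \<in> ball p \<rho> \<Longrightarrow> \<Phi> x \<in> W"
    "\<And>x y. x \<in> ball p \<rho> \<Longrightarrow> y \<in> ball p \<rho> \<Longrightarrow> \<bar>f (\<Phi> x) - f (\<Phi> y)\<bar> \<le> C * norm (x - y)"
proof -
  obtain \<rho>1 C1 where 1: "\<rho>1 > 0" "ball p \<rho>1 \<subseteq> U"
    "\<And>x y. x \<in> ball p \<rho>1 \<Longrightarrow> y \<in> ball p \<rho>1 \<Longrightarrow> norm (\<Phi> x - \<Phi> y) \<le> C1 * norm (x - y)"
    by (rule holo_map_lipschitz[OF hol]) (blast intro: that)
  obtain \<rho>2 C2 where 2: "\<rho>2 > 0" "ball (\<Phi> p) \<rho>2 \<subseteq> W"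
    "\<And>x y. x \<in> ball (\<Phi> p) \<rho>2 \<Longrightarrow> y \<in> ball (\<Phi> p) \<rho>2 \<Longrightarrow> \<bar>f x - f y\<bar> \<le> C2 * norm (x - y)"
    by (rule smooth_lipschitz[OF sm]) (blast intro: that)
  have "isCont \<Phi> p"
    using holo_map_continuous[OF hol(1)] hol(2,3) by (simp add: continuous_on_eq_continuous_at)
  then obtain \<rho>3 where 3: "\<rho>3 > 0" "\<And>x. dist x p < \<rho>3 \<Longrightarrow> dist (\<Phi> x) (\<Phi> p) < \<rho>2"
    using 2(1) unfolding continuous_at_eps_delta by blast
  define \<rho> where "\<rho> = min \<rho>1 \<rho>3"
  have im: "\<Phi> x \<in> ball (\<Phi> p) \<rho>2" if "x \<in> ball p \<rho>" for x
    using 3(2)[of x] \<open>x \<in> ball p \<rho>\<close> by (simp add: \<rho>_def dist_commute)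
  have "\<bar>f (\<Phi> x) - f (\<Phi> y)\<bar> \<le> \<bar>C2\<bar> * C1 * norm (x - y)" if xy: "x \<in> ball p \<rho>" "y \<in> ball p \<rho>" for x y
  proof -
    have "\<bar>f (\<Phi> x) - f (\<Phi> y)\<bar> \<le> C2 * norm (\<Phi> x - \<Phi> y)" by (intro 2(3) im xy)
    also have "\<dots> \<le> \<bar>C2\<bar> * norm (\<Phi> x - \<Phi> y)" by (intro mult_right_mono) auto
    also have "\<dots> \<le> \<bar>C2\<bar> * (C1 * norm (x - y))"
      using xy by (intro mult_left_mono 1(3)) (auto simp: \<rho>_def)
    finally show ?thesis by (simp add: mult.assoc)
  qed
  moreover have "\<rho> > 0" "ball p \<rho> \<subseteq> U" using 1 3 by (auto simp: \<rho>_def)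
  moreover have "\<Phi> x \<in> W" if "x \<in> ball p \<rho>" for x using im[OF that] 2(2) by blast
  ultimately show thesis using that by blast
qed

lemma hol_coordE:
  assumes "hol_coord p U \<Phi>"
  obtains \<Psi> where "open U" "p \<in> U" "open (\<Phi> ` U)" "\<Phi> p = 0" "holo_map_on U \<Phi>"
    "holo_map_on (\<Phi> ` U) \<Psi>" "\<And>z. z \<in> U \<Longrightarrow> \<Psi> (\<Phi> z) = z"
proof -
  from assms have "\<exists>\<Psi>. holo_map_on (\<Phi> ` U) \<Psi> \<and> (\<forall>z\<in>U. \<Psi> (\<Phi> z) = z)"
    unfolding hol_coord_def by (elim conjE)
  then obtain \<Psi> where "holo_map_on (\<Phi> ` U) \<Psi>" "\<forall>z\<in>U. \<Psi> (\<Phi> z) = z" by (elim exE conjE)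
  then show thesis using assms that[of \<Psi>] unfolding hol_coord_def by (elim conjE) simp
qed

lemma local_defining_funE:
  assumes "local_defining_fun M p r"
  obtains W where "open W" "p \<in> W" "smooth_on W r" "M \<inter> W = {z \<in> W. r z = 0}"
    "\<And>z. z \<in> M \<inter> W \<Longrightarrow> frechet_derivative r (at z) \<noteq> (\<lambda>v. 0)"
  using assms unfolding local_defining_fun_def by (elim exE conjE) (metis (lifting))

text \<open>Domination is applied twice: around \<open>p\<close> to \<open>r\<close> and
  \<open>r' \<circ> \<Phi>\<close>, and around 0 to \<open>r'\<close> and
  \<open>r \<circ> \<Psi>\<close>. The second estimate is pulled back by
  \<open>\<Phi>\<close>.\<close>

lemma hol_coord_comparison:
  fixes \<Phi> :: "complex^'n::finite \<Rightarrow> complex^'n"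
  assumes "p \<in> M" and r: "local_defining_fun M p r"
    and coord: "hol_coord p U \<Phi>" and r': "local_defining_fun (\<Phi> ` (M \<inter> U)) 0 r'"
  shows "\<exists>C. \<forall>\<^sub>F z in nhds p. \<bar>r' (\<Phi> z)\<bar> \<le> C * \<bar>r z\<bar>"
    and "\<exists>C. \<forall>\<^sub>F z in nhds p. \<bar>r z\<bar> \<le> C * \<bar>r' (\<Phi> z)\<bar>"
proof -
  obtain \<Psi> where U: "open U" "p \<in> U" "open (\<Phi> ` U)" "\<Phi> p = 0" and
    \<Phi>: "holo_map_on U \<Phi>" and \<Psi>: "holo_map_on (\<Phi> ` U) \<Psi>" "\<And>z. z \<in> U \<Longrightarrow> \<Psi> (\<Phi> z) = z"
    by (rule hol_coordE[OF coord]) (blast intro: that)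
  obtain W where W: "open W" "p \<in> W" "smooth_on W r" "M \<inter> W = {z \<in> W. r z = 0}"
    "\<And>z. z \<in> M \<inter> W \<Longrightarrow> frechet_derivative r (at z) \<noteq> (\<lambda>v. 0)"
    by (rule local_defining_funE[OF r]) (blast intro: that)
  obtain W' where W': "open W'" "0 \<in> W'" "smooth_on W' r'"
    "\<Phi> ` (M \<inter> U) \<inter> W' = {z \<in> W'. r' z = 0}"
    "\<And>z. z \<in> \<Phi> ` (M \<inter> U) \<inter> W' \<Longrightarrow> frechet_derivative r' (at z) \<noteq> (\<lambda>v. 0)"
    by (rule local_defining_funE[OF r']) (blast intro: that)
  have 0: "0 \<in> \<Phi> ` (M \<inter> U)" using U assms(1) by (metis IntI imageI)
  have \<Psi>0: "\<Psi> 0 = p" using \<Psi>(2)[OF U(2)] U(4) by simp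
  have im: "\<Phi> p \<in> W'" and im': "\<Psi> 0 \<in> W" using U(4) W'(2) \<Psi>0 W(2) by simp_all
  have rp: "r p = 0" "r' 0 = 0" using W W' assms(1) 0 by blast+
  obtain \<rho> C where \<rho>: "\<rho> > 0" "ball p \<rho> \<subseteq> U" "\<And>x. x \<in> ball p \<rho> \<Longrightarrow> \<Phi> x \<in> W'"
    "\<And>x y. x \<in> ball p \<rho> \<Longrightarrow> y \<in> ball p \<rho> \<Longrightarrow> \<bar>r' (\<Phi> x) - r' (\<Phi> y)\<bar> \<le> C * norm (x - y)"
    by (rule holo_smooth_lipschitz[OF \<Phi> U(1,2) W'(3,1) im]) (blast intro: that)
  obtain e where e: "e > 0" "ball p e \<subseteq> W" using W(1,2) by (meson open_contains_ball)
  have 1: "\<exists>C. \<forall>\<^sub>F z in nhds p. \<bar>r' (\<Phi> z)\<bar> \<le> C * \<bar>r z\<bar>"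
  proof (rule defining_function_dominates[OF W(3,1,2) rp(1) _ _ \<rho>(4), where \<rho> = "min \<rho> e"])
    show "frechet_derivative r (at p) \<noteq> (\<lambda>v. 0)" using W assms(1) by blast
    fix z assume z: "z \<in> ball p (min \<rho> e)" "r z = 0"
    then have "z \<in> M \<inter> W" using W(4) e by auto
    moreover have "z \<in> U" "\<Phi> z \<in> W'" using z \<rho> by auto
    ultimately have "\<Phi> z \<in> \<Phi> ` (M \<inter> U) \<inter> W'" by blast
    then show "r' (\<Phi> z) = 0" using W'(4) by blast
  qed (use \<rho> e in auto)
  have zU: "0 \<in> \<Phi> ` U" using U(2,4) by (metis imageI)
  obtain \<rho>' C' where \<rho>': "\<rho>' > 0" "ball 0 \<rho>' \<subseteq> \<Phi> ` U" "\<And>x. x \<in> ball 0 \<rho>' \<Longrightarrow> \<Psi> x \<in> W"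
    "\<And>x y. x \<in> ball 0 \<rho>' \<Longrightarrow> y \<in> ball 0 \<rho>' \<Longrightarrow> \<bar>r (\<Psi> x) - r (\<Psi> y)\<bar> \<le> C' * norm (x - y)"
    by (rule holo_smooth_lipschitz[OF \<Psi>(1) U(3) zU W(3,1) im']) (blast intro: that)
  obtain e' where e': "e' > 0" "ball 0 e' \<subseteq> W'" using W'(1,2) by (meson open_contains_ball)
  \<comment> \<open>The roles are exchanged here: the zero is now searched for in the image
    coordinates.\<close>
  have "\<exists>C. \<forall>\<^sub>F w in nhds 0. \<bar>r (\<Psi> w)\<bar> \<le> C * \<bar>r' w\<bar>"
  proof (rule defining_function_dominates[OF W'(3,1,2) rp(2) _ _ \<rho>'(4), where \<rho> = "min \<rho>' e'"])
    show "frechet_derivative r' (at 0) \<noteq> (\<lambda>v. 0)" using W' 0 by blast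
    fix w assume w: "w \<in> ball 0 (min \<rho>' e')" "r' w = 0"
    then have "w \<in> W'" using e' by auto
    then have "w \<in> \<Phi> ` (M \<inter> U)" using W'(4) w(2) by blast
    then have "\<Psi> w \<in> M" using \<Psi>(2) by auto
    moreover have "\<Psi> w \<in> W" using w \<rho>' by auto
    ultimately show "r (\<Psi> w) = 0" using W(4) by blast
  qed (use \<rho>' e' in auto)
  then obtain D where D: "\<forall>\<^sub>F w in nhds 0. \<bar>r (\<Psi> w)\<bar> \<le> D * \<bar>r' w\<bar>" by blast
  have "isCont \<Phi> p"
    using holo_map_continuous[OF \<Phi>] U(1,2) by (simp add: continuous_on_eq_continuous_at)
  then have "filterlim \<Phi> (nhds (\<Phi> p)) (nhds p)"
    by (simp add: isCont_def tendsto_at_iff_tendsto_nhds)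
  then have "filterlim \<Phi> (nhds 0) (nhds p)" by (simp add: U(4))
  from eventually_compose_filterlim[OF D this] eventually_nhds_in_open[OF U(1,2)]
  have "\<forall>\<^sub>F z in nhds p. \<bar>r z\<bar> \<le> D * \<bar>r' (\<Phi> z)\<bar>"
    by eventually_elim (simp add: \<Psi>(2))
  with 1 show "\<exists>C. \<forall>\<^sub>F z in nhds p. \<bar>r' (\<Phi> z)\<bar> \<le> C * \<bar>r z\<bar>"
    and "\<exists>C. \<forall>\<^sub>F z in nhds p. \<bar>r z\<bar> \<le> C * \<bar>r' (\<Phi> z)\<bar>"
    by blast+
qed

section \<open>Regular curves of infinite tangency from a missed axis\<close>

lemma bigo_dominated:
  fixes f g :: "complex \<Rightarrow> real"
  assumes "\<forall>\<^sub>F t in at 0. \<bar>f t\<bar> \<le> C * \<bar>g t\<bar>" "g \<in> O[at 0](h)"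
  shows "f \<in> O[at 0](h)"
  by (rule landau_o.big_trans[OF bigoI[of f C] assms(2)]) (use assms(1) in simp)

text \<open>The curve is the axis carried back by \<open>\<Psi>\<close>. Its order is exactly 1
  because both coordinate maps are Lipschitz: \<open>\<Psi>\<close> gives the lower bound on the
  order and \<open>\<Phi>\<close> the upper one. Injectivity also comes from
  \<open>\<Phi>\<close>.\<close>

lemma nonconvenient_imp_tangent:
  fixes \<Phi> :: "complex^'n::finite \<Rightarrow> complex^'n"
  assumes "p \<in> M" and r: "local_defining_fun M p r"
    and coord: "hol_coord p U \<Phi>" and r': "local_defining_fun (\<Phi> ` (M \<inter> U)) 0 r'"
    and "\<not> convenient r'"
  shows "\<exists>\<gamma>\<in>Gamma_reg p. inf_tangent r \<gamma>"
proof -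
  obtain \<Psi> where U: "open U" "p \<in> U" "open (\<Phi> ` U)" "\<Phi> p = 0" and
    \<Phi>: "holo_map_on U \<Phi>" and \<Psi>: "holo_map_on (\<Phi> ` U) \<Psi>" "\<And>z. z \<in> U \<Longrightarrow> \<Psi> (\<Phi> z) = z"
    by (rule hol_coordE[OF coord]) (blast intro: that)
  have \<Psi>0: "\<Psi> 0 = p" using \<Psi>(2)[OF U(2)] U(4) by simp
  have 0: "0 \<in> \<Phi> ` U" using U(2,4) by (metis imageI)
  have \<Phi>\<Psi>: "\<Phi> (\<Psi> w) = w" "\<Psi> w \<in> U" if "w \<in> \<Phi> ` U" for w using that \<Psi>(2) by auto
  obtain W' where W': "open W'" "0 \<in> W'" "smooth_on W' r'"
    by (rule local_defining_funE[OF r'])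
  obtain j where "\<forall>N. (\<lambda>t. r' (axis j t)) \<in> O[at 0](\<lambda>t. norm t ^ N)"
    using not_convenient_axis[OF W'(3,1,2) assms(5)] ..
  then have j: "(\<lambda>t. r' (axis j t)) \<in> O[at 0](\<lambda>t. norm t ^ N)" for N ..
  obtain \<epsilon> C1 where \<epsilon>: "\<epsilon> > 0" "ball 0 \<epsilon> \<subseteq> \<Phi> ` U"
    "\<And>x y. x \<in> ball 0 \<epsilon> \<Longrightarrow> y \<in> ball 0 \<epsilon> \<Longrightarrow> norm (\<Psi> x - \<Psi> y) \<le> C1 * norm (x - y)"
    by (rule holo_map_lipschitz[OF \<Psi>(1) U(3) 0]) (blast intro: that)
  define \<gamma> where "\<gamma> t = \<Psi> (axis j t)" for t
  have ax: "axis j t \<in> ball 0 \<epsilon>" if "t \<in> ball 0 \<epsilon>" for t :: complex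
    using that by (simp add: norm_axis_eq)
  have axU: "axis j t \<in> \<Phi> ` U" if "t \<in> ball 0 \<epsilon>" for t :: complex
    using ax[OF that] \<epsilon>(2) by blast
  have inj: "inj_on \<gamma> (ball 0 \<epsilon>)"
  proof (rule inj_onI)
    fix x y assume "x \<in> ball 0 \<epsilon>" "y \<in> ball 0 \<epsilon>" "\<gamma> x = \<gamma> y"
    then have "axis j x = axis j y" using \<Phi>\<Psi>(1)[OF axU] unfolding \<gamma>_def by metis
    then show "x = y" by (auto simp: axis_eq_axis)
  qed
  have ax0: "axis j 0 = (0 :: complex^'n)" by (simp add: vec_eq_iff axis_def)
  have \<gamma>0: "\<gamma> 0 = p" by (simp add: \<gamma>_def ax0 \<Psi>0)
  have hol: "(\<lambda>t. \<gamma> t $ i) holomorphic_on ball 0 \<epsilon>" for i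
    unfolding holomorphic_on_def field_differentiable_def
  proof
    fix t :: complex assume t: "t \<in> ball 0 \<epsilon>"
    then have "\<exists>L. (\<Psi> has_derivative L) (at (axis j t)) \<and> (\<forall>(c::complex) w. L (c *s w) = c *s L w)"
      using \<Psi>(1) axU[OF t] unfolding holo_map_on_def by blast
    then obtain L where L: "(\<Psi> has_derivative L) (at (axis j t))" "\<And>(c::complex) w. L (c *s w) = c *s L w"
      by blast
    have "((\<lambda>t. axis j t $ i) has_field_derivative axis j 1 $ i) (at t)" for i
      by (auto simp: axis_def)
    from holo_map_comp_nth[where g = "axis j", OF L this]
    have "((\<lambda>t. \<gamma> t $ i) has_field_derivative L (axis j 1) $ i) (at t)" unfolding \<gamma>_def .
    then show "\<exists>D. ((\<lambda>t. \<gamma> t $ i) has_field_derivative D) (at t within ball 0 \<epsilon>)"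
      using has_field_derivative_at_within by blast
  qed
  have ev: "\<forall>\<^sub>F t::complex in at 0. t \<in> ball 0 \<epsilon>"
    using \<epsilon>(1) by (intro eventually_at_in_open') auto
  have nz: "\<gamma> (of_real (\<epsilon> / 2)) \<noteq> p"
    using inj_onD[OF inj, of "of_real (\<epsilon> / 2)" 0] \<gamma>0 \<epsilon>(1) by auto
  have \<Gamma>: "\<gamma> \<in> Gamma p"
    unfolding Gamma_def using \<epsilon>(1) hol \<gamma>0 inj nz
    by (auto intro!: exI[of _ \<epsilon>] bexI[of _ "of_real (\<epsilon> / 2)"])
  have isCont: "filterlim \<gamma> (nhds p) (at 0)"
  proof -
    have "((\<lambda>t. \<gamma> t $ i) \<longlongrightarrow> \<gamma> 0 $ i) (at 0)" for i
      using holomorphic_on_imp_continuous_on[OF hol[of i]] \<epsilon>(1)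
      by (simp add: continuous_on_eq_continuous_at isCont_def)
    then show ?thesis by (intro vec_tendstoI) (simp add: \<gamma>0)
  qed
  have "vanish_ord (\<lambda>t. \<gamma> t - p) = 1"
  proof (rule antisym)
    have "(\<lambda>t. norm (\<gamma> t - p)) \<in> O[at 0](\<lambda>t. norm t ^ 1)"
    proof (rule bigoI[of _ C1])
      show "\<forall>\<^sub>F t in at 0. norm (norm (\<gamma> t - p)) \<le> C1 * norm (norm t ^ 1)"
        using ev
      proof eventually_elim
        case (elim t)
        then show ?case
          using \<epsilon>(3)[OF ax[OF elim], of 0] \<epsilon>(1) by (simp add: \<gamma>_def \<Psi>0 norm_axis_eq)
      qed
    qed
    from vanish_ord_ge[OF this] show "1 \<le> vanish_ord (\<lambda>t. \<gamma> t - p)" by (simp add: one_enat_def)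
    obtain \<rho> C2 where \<rho>: "\<rho> > 0" "ball p \<rho> \<subseteq> U"
      "\<And>x y. x \<in> ball p \<rho> \<Longrightarrow> y \<in> ball p \<rho> \<Longrightarrow> norm (\<Phi> x - \<Phi> y) \<le> C2 * norm (x - y)"
      by (rule holo_map_lipschitz[OF \<Phi> U(1,2)]) (blast intro: that)
    have "\<forall>\<^sub>F t in at 0. \<gamma> t \<in> ball p \<rho>"
      using eventually_compose_filterlim[OF _ isCont] eventually_nhds_in_open[of "ball p \<rho>" p] \<rho>(1) by simp
    with ev have le: "\<forall>\<^sub>F t in at 0. \<bar>norm t\<bar> \<le> C2 * \<bar>norm (\<gamma> t - p)\<bar>"
    proof eventually_elim
      case (elim t)
      have "\<Phi> (\<gamma> t) = axis j t" unfolding \<gamma>_def by (rule \<Phi>\<Psi>(1)[OF axU[OF elim(1)]])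
      then show ?case using \<rho>(3)[OF elim(2), of p] \<rho>(1) U(4) by (simp add: norm_axis_eq)
    qed
    have "(\<lambda>t. norm (\<gamma> t - p)) \<notin> O[at 0](\<lambda>t. norm t ^ Suc 1)"
    proof
      assume "(\<lambda>t. norm (\<gamma> t - p)) \<in> O[at 0](\<lambda>t. norm t ^ Suc 1)"
      from bigo_dominated[OF le this]
      obtain B where B: "B > 0" "\<forall>\<^sub>F t::complex in at 0. norm (norm t) \<le> B * norm (norm t ^ Suc 1)"
        by (auto elim: landau_o.bigE)
      have "\<forall>\<^sub>F t::complex in at 0. norm t < 1 / B"
        using B(1) by (auto simp: eventually_at intro!: exI[of _ "1 / B"])
      with B(2) eventually_neq_at_within[of 0] have "\<forall>\<^sub>F t::complex in at 0. False"
        by eventually_elim (use B(1) in \<open>simp add: field_simps power2_eq_square\<close>)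
      then show False by simp
    qed
    from vanish_ord_le[OF this] show "vanish_ord (\<lambda>t. \<gamma> t - p) \<le> 1" by (simp add: one_enat_def)
  qed
  with \<Gamma> have "\<gamma> \<in> Gamma_reg p" by (simp add: Gamma_reg_def)
  moreover have "inf_tangent r \<gamma>"
    unfolding inf_tangent_def
  proof
    fix N
    obtain C where "\<forall>\<^sub>F z in nhds p. \<bar>r z\<bar> \<le> C * \<bar>r' (\<Phi> z)\<bar>"
      using hol_coord_comparison(2)[OF assms(1-4)] by blast
    from eventually_compose_filterlim[OF this isCont] ev
    have "\<forall>\<^sub>F t in at 0. \<bar>r (\<gamma> t)\<bar> \<le> C * \<bar>r' (axis j t)\<bar>"
    proof eventually_elim
      case (elim t)
      have "\<Phi> (\<gamma> t) = axis j t" unfolding \<gamma>_def by (rule \<Phi>\<Psi>(1)[OF axU[OF elim(2)]])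
      with elim(1) show ?case by simp
    qed
    then show "(\<lambda>t. r (\<gamma> t)) \<in> O[at 0](\<lambda>t. norm t ^ N)" by (rule bigo_dominated[OF _ j])
  qed
  ultimately show ?thesis by blast
qed

section \<open>A uniform bound on contact orders of arbitrary curves\<close>

lemma holomorphic_leading_term:
  assumes "f holomorphic_on ball 0 \<epsilon>" "f 0 = 0" "\<exists>t\<in>ball 0 \<epsilon>. f t \<noteq> 0"
  shows "\<exists>n c. n > 0 \<and> c \<noteq> 0 \<and> ((\<lambda>t. f t / t ^ n) \<longlongrightarrow> c) (at 0)"
proof -
  have 0: "0 \<in> ball 0 \<epsilon>" using assms(3) by (auto intro: le_less_trans[OF norm_ge_zero])
  have nc: "\<not> f constant_on ball 0 \<epsilon>" using assms(2,3) 0 unfolding constant_on_def by metis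
  obtain g r n where g: "0 < n" "0 < r" "g holomorphic_on ball 0 r"
    "\<And>w. w \<in> ball 0 r \<Longrightarrow> f w = (w - 0) ^ n * g w" "\<And>w. w \<in> ball 0 r \<Longrightarrow> g w \<noteq> 0"
    by (rule holomorphic_factor_zero_nonconstant[OF assms(1) open_ball connected_ball 0 assms(2) nc])
      (blast intro: that)
  have "(g \<longlongrightarrow> g 0) (at 0)"
    using holomorphic_on_imp_continuous_on[OF g(3)] g(2)
    by (simp add: continuous_on_eq_continuous_at isCont_def)
  moreover have "\<forall>\<^sub>F t in at 0. t \<in> ball 0 r - {0}"
    using g(2) by (intro eventually_at_in_open) auto
  then have "\<forall>\<^sub>F t in at 0. g t = f t / t ^ n"
    by eventually_elim (simp add: g(4))
  ultimately have "((\<lambda>t. f t / t ^ n) \<longlongrightarrow> g 0) (at 0)" by (rule Lim_transform_eventually)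
  then show ?thesis using g(1,2) g(5)[of 0] by auto
qed

text \<open>A component of the curve that vanishes identically is replaced by a power of \<open>t\<close> so high
  that the order of \<open>r'\<close> along the curve is not affected.\<close>

lemma Gamma_type_bound:
  fixes \<Phi> :: "complex^'n::finite \<Rightarrow> complex^'n"
  assumes "p \<in> M" and r: "local_defining_fun M p r"
    and coord: "hol_coord p U \<Phi>" and r': "local_defining_fun (\<Phi> ` (M \<inter> U)) 0 r'"
    and nd: "N_nondegenerate r'" and conv: "convenient r'"
  shows "\<exists>K::nat. \<forall>\<gamma>\<in>Gamma p. \<exists>A::nat. 0 < A \<and> enat A \<le> vanish_ord (\<lambda>t. \<gamma> t - p) \<and>
    vanish_ord (r \<circ> \<gamma>) \<le> enat (K * A)"
proof -
  obtain \<Psi> where U: "open U" "p \<in> U" "open (\<Phi> ` U)" "\<Phi> p = 0" and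
    \<Phi>: "holo_map_on U \<Phi>" and \<Psi>: "holo_map_on (\<Phi> ` U) \<Psi>" "\<And>z. z \<in> U \<Longrightarrow> \<Psi> (\<Phi> z) = z"
    by (rule hol_coordE[OF coord]) (blast intro: that)
  obtain W' where W': "open W'" "0 \<in> W'" "smooth_on W' r'"
    by (rule local_defining_funE[OF r'])
  have zU: "0 \<in> \<Phi> ` U" using U(2,4) by (metis imageI)
  have \<Psi>0: "\<Psi> 0 = p" using \<Psi>(2)[OF U(2)] U(4) by simp
  obtain C1 where C1: "\<forall>\<^sub>F z in nhds p. \<bar>r' (\<Phi> z)\<bar> \<le> C1 * \<bar>r z\<bar>"
    using hol_coord_comparison(1)[OF assms(1-4)] ..
  obtain \<rho> C2 where \<rho>: "\<rho> > 0" "ball 0 \<rho> \<subseteq> W'"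
    "\<And>x y. x \<in> ball 0 \<rho> \<Longrightarrow> y \<in> ball 0 \<rho> \<Longrightarrow> \<bar>r' x - r' y\<bar> \<le> C2 * norm (x - y)"
    by (rule smooth_lipschitz[OF W'(3,1,2)]) (blast intro: that)
  obtain \<rho>' C3 where \<rho>': "\<rho>' > 0" "ball 0 \<rho>' \<subseteq> \<Phi> ` U"
    "\<And>x y. x \<in> ball 0 \<rho>' \<Longrightarrow> y \<in> ball 0 \<rho>' \<Longrightarrow> norm (\<Psi> x - \<Psi> y) \<le> C3 * norm (x - y)"
    by (rule holo_map_lipschitz[OF \<Psi>(1) U(3) zU]) (blast intro: that)
  obtain K where "\<forall>\<delta> c a. (\<forall>j. a j > 0 \<and> c $ j \<noteq> 0 \<and> ((\<lambda>t. \<delta> t $ j / t ^ a j) \<longlongrightarrow> c $ j) (at 0)) \<longrightarrow>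
    (\<exists>l. (\<forall>j. l \<le> K * a j) \<and> (\<lambda>t. norm (r' (\<delta> t))) \<notin> O[at 0](\<lambda>t. norm t ^ Suc l))"
    using convenient_type_bound[OF W'(3,1,2) nd conv] ..
  note K = this[rule_format]
  have "\<exists>A::nat. 0 < A \<and> enat A \<le> vanish_ord (\<lambda>t. \<gamma> t - p) \<and> vanish_ord (r \<circ> \<gamma>) \<le> enat (K * A)"
    if "\<gamma> \<in> Gamma p" for \<gamma>
  proof -
    from that obtain \<epsilon>0 where e0: "\<epsilon>0 > 0" "\<forall>j. (\<lambda>t. \<gamma> t $ j) holomorphic_on ball 0 \<epsilon>0"
      "\<gamma> 0 = p" "inj_on \<gamma> (ball 0 \<epsilon>0)"
      unfolding Gamma_def mem_Collect_eq by (elim exE conjE)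
    note \<epsilon>0 = e0(1) e0(2)[rule_format] e0(3,4)
    have lim\<gamma>: "filterlim \<gamma> (nhds p) (at 0)"
    proof -
      have "((\<lambda>t. \<gamma> t $ i) \<longlongrightarrow> \<gamma> 0 $ i) (at 0)" for i
        using holomorphic_on_imp_continuous_on[OF \<epsilon>0(2)[of i]] \<epsilon>0(1)
        by (simp add: continuous_on_eq_continuous_at isCont_def)
      then show ?thesis by (intro vec_tendstoI) (simp add: \<epsilon>0)
    qed
    have "\<forall>\<^sub>F t in at 0. \<gamma> t \<in> U"
      using eventually_compose_filterlim[OF eventually_nhds_in_open[OF U(1,2)] lim\<gamma>] .
    then obtain \<epsilon>1 where \<epsilon>1: "\<epsilon>1 > 0" "\<And>t. t \<noteq> 0 \<Longrightarrow> dist t 0 < \<epsilon>1 \<Longrightarrow> \<gamma> t \<in> U"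
      unfolding eventually_at by auto
    define \<epsilon> where "\<epsilon> = min \<epsilon>0 \<epsilon>1"
    have \<epsilon>: "\<epsilon> > 0" using \<epsilon>0(1) \<epsilon>1(1) by (simp add: \<epsilon>_def)
    have \<gamma>U: "\<gamma> t \<in> U" if "t \<in> ball 0 \<epsilon>" for t
      using \<epsilon>1(2)[of t] that \<epsilon>0(3) U(2) by (cases "t = 0") (auto simp: \<epsilon>_def)
    define \<delta> where "\<delta> t = \<Phi> (\<gamma> t)" for t
    have \<delta>0: "\<delta> 0 = 0" by (simp add: \<delta>_def \<epsilon>0 U)
    have hol: "(\<lambda>t. \<delta> t $ j) holomorphic_on ball 0 \<epsilon>" for j
      unfolding holomorphic_on_def field_differentiable_def
    proof
      fix t :: complex assume t: "t \<in> ball 0 \<epsilon>"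
      then have "\<exists>L. (\<Phi> has_derivative L) (at (\<gamma> t)) \<and> (\<forall>(c::complex) w. L (c *s w) = c *s L w)"
        using \<Phi> \<gamma>U[OF t] unfolding holo_map_on_def by blast
      then obtain L where L: "(\<Phi> has_derivative L) (at (\<gamma> t))" "\<And>(c::complex) w. L (c *s w) = c *s L w"
        by blast
      define D where "D = (\<chi> i. deriv (\<lambda>t. \<gamma> t $ i) t)"
      have "((\<lambda>t. \<gamma> t $ i) has_field_derivative D $ i) (at t)" for i
        unfolding D_def vec_lambda_beta
        by (rule holomorphic_derivI[OF \<epsilon>0(2) open_ball]) (use t in \<open>auto simp: \<epsilon>_def\<close>)
      from holo_map_comp_nth[where g = \<gamma>, OF L this]
      have "((\<lambda>t. \<delta> t $ j) has_field_derivative L D $ j) (at t)" unfolding \<delta>_def .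
      then show "\<exists>D. ((\<lambda>t. \<delta> t $ j) has_field_derivative D) (at t within ball 0 \<epsilon>)"
        using has_field_derivative_at_within by blast
    qed
    have lim\<delta>: "(\<delta> \<longlongrightarrow> 0) (at 0)"
    proof (rule vec_tendstoI)
      fix i
      have "((\<lambda>t. \<delta> t $ i) \<longlongrightarrow> \<delta> 0 $ i) (at 0)"
        using holomorphic_on_imp_continuous_on[OF hol[of i]] \<epsilon>
        by (simp add: continuous_on_eq_continuous_at isCont_def)
      then show "((\<lambda>t. \<delta> t $ i) \<longlongrightarrow> 0 $ i) (at 0)" by (simp add: \<delta>0)
    qed
    \<comment> \<open>The components with a leading term. If there were none, injectivity of
      \<open>\<gamma>\<close> would fail.\<close>
    define J where "J = {j. \<exists>t\<in>ball 0 \<epsilon>. \<delta> t $ j \<noteq> 0}"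
    have "\<forall>j. \<exists>n c. j \<in> J \<longrightarrow> n > 0 \<and> c \<noteq> 0 \<and> ((\<lambda>t. \<delta> t $ j / t ^ n) \<longlongrightarrow> c) (at 0)"
      using holomorphic_leading_term[OF hol] \<delta>0 unfolding J_def by auto
    then obtain a c where ac: "\<And>j. j \<in> J \<Longrightarrow> 0 < (a j :: nat)" "\<And>j. j \<in> J \<Longrightarrow> c j \<noteq> 0"
      "\<And>j. j \<in> J \<Longrightarrow> ((\<lambda>t. \<delta> t $ j / t ^ a j) \<longlongrightarrow> c j) (at 0)"
      by metis
    have "J \<noteq> {}"
    proof
      assume "J = {}"
      define t where "t = complex_of_real (\<epsilon> / 2)"
      have t: "t \<in> ball 0 \<epsilon>" "t \<noteq> 0" using \<epsilon> by (auto simp: t_def)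
      then have "\<delta> t = 0" using \<open>J = {}\<close> by (auto simp: J_def vec_eq_iff)
      then have "\<gamma> t = p" using \<Psi>(2)[OF \<gamma>U[OF t(1)]] \<Psi>0 by (simp add: \<delta>_def)
      then show False using inj_onD[OF \<epsilon>0(4), of t 0] t \<epsilon>0(1,3) by (auto simp: \<epsilon>_def)
    qed
    \<comment> \<open>The least order among the components of \<open>\<delta>\<close>. By the
      Lipschitz bound for \<open>\<Psi>\<close> it is a lower bound for the order of
      \<open>\<gamma> - p\<close>, the direction required of a denominator.\<close>
    define A where "A = Min (a ` J)"
    have A: "\<And>j. j \<in> J \<Longrightarrow> A \<le> a j" "A \<in> a ` J"
      using \<open>J \<noteq> {}\<close> by (auto simp: A_def)
    then have "A > 0" using ac(1) by auto
    have vanish: "\<forall>\<^sub>F t in at 0. \<forall>j. j \<notin> J \<longrightarrow> \<delta> t $ j = 0"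
      using eventually_at_in_open'[of "ball 0 \<epsilon>" 0] \<epsilon> by (auto simp: J_def elim!: eventually_mono)
    have ne: "\<forall>\<^sub>F t::complex in at 0. t \<noteq> 0" by (rule eventually_neq_at_within)
    have comp: "(\<lambda>t. norm (\<delta> t $ j)) \<in> O[at 0](\<lambda>t. norm t ^ A)" for j
    proof (cases "j \<in> J")
      case True
      have "(\<lambda>t. \<delta> t $ j) \<in> O[at 0](\<lambda>t. t ^ a j)"
        by (rule bigoI_tendsto[OF ac(3)[OF True]]) (rule eventually_mono[OF ne], simp)
      then have "(\<lambda>t. norm (\<delta> t $ j)) \<in> O[at 0](\<lambda>t. norm (t ^ a j))" by simp
      then have "(\<lambda>t. norm (\<delta> t $ j)) \<in> O[at 0](\<lambda>t. norm t ^ a j)" by (simp only: norm_power)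
      then show ?thesis
        by (rule landau_o.big_trans[OF _ bigo_power_mono[OF A(1)[OF True]]])
    next
      case False
      then show ?thesis
        using vanish by (intro bigoI[of _ 0]) (auto elim!: eventually_mono)
    qed
    have "(\<lambda>t. norm (\<gamma> t - p)) \<in> O[at 0](\<lambda>t. norm t ^ A)"
    proof (rule bigo_dominated)
      show "(\<lambda>t. \<Sum>j\<in>UNIV. norm (\<delta> t $ j)) \<in> O[at 0](\<lambda>t. norm t ^ A)"
        by (rule big_sum_in_bigo) (rule comp)
      have "\<forall>\<^sub>F t in at 0. \<delta> t \<in> ball 0 \<rho>'"
        using lim\<delta> \<rho>'(1) by (auto dest!: topological_tendstoD[of _ _ _ "ball 0 \<rho>'"])
      moreover have "\<forall>\<^sub>F t in at 0. \<gamma> t \<in> U"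
        using eventually_compose_filterlim[OF eventually_nhds_in_open[OF U(1,2)] lim\<gamma>] .
      ultimately show "\<forall>\<^sub>F t in at 0. \<bar>norm (\<gamma> t - p)\<bar> \<le> \<bar>C3\<bar> * \<bar>\<Sum>j\<in>UNIV. norm (\<delta> t $ j)\<bar>"
      proof eventually_elim
        case (elim t)
        have "norm (\<gamma> t - p) = norm (\<Psi> (\<delta> t) - \<Psi> 0)" by (simp add: \<delta>_def \<Psi>(2)[OF elim(2)] \<Psi>0)
        also have "\<dots> \<le> C3 * norm (\<delta> t - 0)" using elim(1) \<rho>'(1) by (intro \<rho>'(3)) auto
        also have "\<dots> \<le> \<bar>C3\<bar> * (\<Sum>j\<in>UNIV. norm (\<delta> t $ j))"
          by (intro mult_mono) (auto simp: norm_vec_def intro!: L2_set_le_sum)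
        finally show ?case by (simp add: sum_nonneg)
      qed
    qed
    then have ordA: "enat A \<le> vanish_ord (\<lambda>t. \<gamma> t - p)" by (rule vanish_ord_ge)
    \<comment> \<open>One more than the bound to be proved, so that a change of size
      \<open>t ^ N\<close> cannot disturb an order up to \<open>K * A\<close>. There is no
      circularity, as \<open>K\<close> was fixed before the curve.\<close>
    define N where "N = Suc (K * A)"
    define \<delta>' where "\<delta>' t = (\<chi> j. if j \<in> J then \<delta> t $ j else t ^ N)" for t
    have "\<exists>l. (\<forall>j. l \<le> K * (if j \<in> J then a j else N)) \<and> (\<lambda>t. norm (r' (\<delta>' t))) \<notin> O[at 0](\<lambda>t. norm t ^ Suc l)"
    proof (rule K[where c = "\<chi> j. if j \<in> J then c j else 1"])
      fix j
      have "((\<lambda>t. t ^ N / t ^ N) \<longlongrightarrow> (1::complex)) (at 0)"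
        by (rule Lim_transform_eventually[OF tendsto_const]) (rule eventually_mono[OF ne], simp)
      then show "(if j \<in> J then a j else N) > 0 \<and> (\<chi> j. if j \<in> J then c j else 1) $ j \<noteq> 0 \<and>
        ((\<lambda>t. \<delta>' t $ j / t ^ (if j \<in> J then a j else N)) \<longlongrightarrow> (\<chi> j. if j \<in> J then c j else 1) $ j) (at 0)"
        using ac[of j] by (simp add: \<delta>'_def N_def)
    qed
    then obtain l where l: "\<And>j. l \<le> K * (if j \<in> J then a j else N)"
      "(\<lambda>t. norm (r' (\<delta>' t))) \<notin> O[at 0](\<lambda>t. norm t ^ Suc l)"
      by blast
    \<comment> \<open>The bound on \<open>l\<close> is read off at an index attaining
      \<open>A\<close>; at a filled-in index it would involve \<open>N\<close>.\<close>
    obtain j0 where "j0 \<in> J" "A = a j0" using A(2) by blast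
    then have lA: "l \<le> K * A" using l(1)[of j0] by simp
    have "(\<lambda>t. norm (r (\<gamma> t))) \<notin> O[at 0](\<lambda>t. norm t ^ Suc l)"
    proof
      assume bigo: "(\<lambda>t. norm (r (\<gamma> t))) \<in> O[at 0](\<lambda>t. norm t ^ Suc l)"
      have "\<forall>\<^sub>F t in at 0. \<bar>r' (\<delta> t)\<bar> \<le> C1 * \<bar>norm (r (\<gamma> t))\<bar>"
        using eventually_compose_filterlim[OF C1 lim\<gamma>] by (simp add: \<delta>_def)
      then have 1: "(\<lambda>t. r' (\<delta> t)) \<in> O[at 0](\<lambda>t. norm t ^ Suc l)"
        by (rule bigo_dominated[OF _ bigo])
      have lim\<delta>': "(\<delta>' \<longlongrightarrow> 0) (at 0)"
      proof (rule vec_tendstoI)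
        fix i
        have "((\<lambda>t::complex. t ^ N) \<longlongrightarrow> 0) (at 0)" by (auto intro!: tendsto_eq_intros simp: N_def)
        then show "((\<lambda>t. \<delta>' t $ i) \<longlongrightarrow> 0 $ i) (at 0)"
          using tendsto_vec_nth[OF lim\<delta>, of i] by (cases "i \<in> J") (simp_all add: \<delta>'_def)
      qed
      have "\<forall>\<^sub>F t in at 0. \<delta> t \<in> ball 0 \<rho>" "\<forall>\<^sub>F t in at 0. \<delta>' t \<in> ball 0 \<rho>"
        using lim\<delta> lim\<delta>' \<rho>(1) by (auto dest!: topological_tendstoD[of _ _ _ "ball 0 \<rho>"])
      then have le: "\<forall>\<^sub>F t in at 0. \<bar>r' (\<delta>' t) - r' (\<delta> t)\<bar> \<le> \<bar>C2\<bar> * real CARD('n) * \<bar>norm t ^ N\<bar>"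
        using vanish
      proof eventually_elim
        case (elim t)
        have "norm (\<delta>' t - \<delta> t) \<le> (\<Sum>j\<in>UNIV. norm ((\<delta>' t - \<delta> t) $ j))"
          unfolding norm_vec_def by (rule L2_set_le_sum) simp
        also have "\<dots> \<le> (\<Sum>j\<in>(UNIV::'n set). norm t ^ N)"
          by (rule sum_mono) (use elim(3) in \<open>auto simp: \<delta>'_def norm_power\<close>)
        finally have "norm (\<delta>' t - \<delta> t) \<le> real CARD('n) * norm t ^ N" by simp
        then have "\<bar>C2\<bar> * norm (\<delta>' t - \<delta> t) \<le> \<bar>C2\<bar> * (real CARD('n) * norm t ^ N)"
          by (rule mult_left_mono) simp
        moreover have "\<bar>r' (\<delta>' t) - r' (\<delta> t)\<bar> \<le> C2 * norm (\<delta>' t - \<delta> t)"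
          by (rule \<rho>(3)[OF elim(2,1)])
        moreover have "C2 * norm (\<delta>' t - \<delta> t) \<le> \<bar>C2\<bar> * norm (\<delta>' t - \<delta> t)"
          by (rule mult_right_mono) auto
        ultimately show ?case by (simp add: mult.assoc)
      qed
      have "Suc l \<le> N" using lA by (simp add: N_def)
      then have "(\<lambda>t. r' (\<delta>' t) - r' (\<delta> t)) \<in> O[at 0](\<lambda>t. norm t ^ Suc l)"
        by (intro bigo_dominated[OF le] bigo_power_mono)
      from sum_in_bigo(1)[OF this 1] have "(\<lambda>t. r' (\<delta>' t)) \<in> O[at 0](\<lambda>t. norm t ^ Suc l)" by simp
      then show False using l(2) by simp
    qed
    then have "vanish_ord (r \<circ> \<gamma>) \<le> enat l" by (intro vanish_ord_le) simp
    also have "\<dots> \<le> enat (K * A)" using lA by simp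
    finally show ?thesis using \<open>A > 0\<close> ordA by blast
  qed
  then show ?thesis by blast
qed

section \<open>Passage to the suprema, and the equivalences\<close>

lemma Delta1_le:
  assumes "\<forall>\<gamma>\<in>Gamma p. \<exists>A::nat. 0 < A \<and> enat A \<le> vanish_ord (\<lambda>t. \<gamma> t - p) \<and>
    vanish_ord (r \<circ> \<gamma>) \<le> enat (K * A)"
  shows "Delta1 r p \<le> ereal (real K)"
  unfolding Delta1_def
proof (rule SUP_least)
  fix \<gamma> assume "\<gamma> \<in> Gamma p"
  then obtain A where A: "0 < A" "enat A \<le> vanish_ord (\<lambda>t. \<gamma> t - p)" "vanish_ord (r \<circ> \<gamma>) \<le> enat (K * A)"
    using assms by blast
  obtain v where v: "vanish_ord (r \<circ> \<gamma>) = enat v" "v \<le> K * A"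
    using A(3) by (cases "vanish_ord (r \<circ> \<gamma>)") auto
  show "ereal_of_enat (vanish_ord (r \<circ> \<gamma>)) / ereal_of_enat (vanish_ord (\<lambda>t. \<gamma> t - p)) \<le> ereal (real K)"
  proof (cases "vanish_ord (\<lambda>t. \<gamma> t - p)")
    case (enat q)
    then have q: "A \<le> q" using A(2) by simp
    have "v \<le> K * q" using v(2) mult_le_mono2[OF q, of K] by linarith
    then have "real v \<le> real K * real q" by (metis of_nat_le_iff of_nat_mult)
    then have "real v / real q \<le> real K" using q A(1) by (simp add: divide_le_eq)
    then show ?thesis using enat v q A(1) by simp
  \<comment> \<open>Were the order of \<open>\<gamma> - p\<close> infinite, the quotient would be a
    finite number divided by infinity, which is 0 in \<open>ereal\<close>.\<close>
  qed (use v in simp)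
qed

lemma Delta1_reg_le:
  assumes "\<forall>\<gamma>\<in>Gamma p. \<exists>A::nat. 0 < A \<and> enat A \<le> vanish_ord (\<lambda>t. \<gamma> t - p) \<and>
    vanish_ord (r \<circ> \<gamma>) \<le> enat (K * A)"
  shows "Delta1_reg r p \<le> enat K"
  unfolding Delta1_reg_def
proof (rule SUP_least)
  fix \<gamma> assume "\<gamma> \<in> Gamma_reg p"
  then obtain A where A: "enat A \<le> 1" "vanish_ord (r \<circ> \<gamma>) \<le> enat (K * A)"
    using assms unfolding Gamma_reg_def by force
  then have "K * A \<le> K" by (simp add: one_enat_def)
  then show "vanish_ord (r \<circ> \<gamma>) \<le> enat K" using A(2) order_trans enat_ord_simps(1) by blast
qed

theorem theorem1p3:
  fixes M :: "(complex^'n::finite) set" and p :: "complex^'n" and r :: "complex^'n \<Rightarrow> real"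
  assumes "real_hypersurface M" and "p \<in> M" and "local_defining_fun M p r"
    and "has_N_canonical_coord M p"
  shows "(Delta1 r p = \<infinity> \<longleftrightarrow> Delta1_reg r p = \<infinity>)
       \<and> (Delta1_reg r p = \<infinity> \<longleftrightarrow> (\<exists>\<gamma> \<in> Gamma_reg p. inf_tangent r \<gamma>))
       \<and> ((\<exists>\<gamma> \<in> Gamma_reg p. inf_tangent r \<gamma>) \<longleftrightarrow> (\<exists>\<gamma> \<in> Gamma p. inf_tangent r \<gamma>))
       \<and> ((\<exists>\<gamma> \<in> Gamma p. inf_tangent r \<gamma>) \<longleftrightarrow>
            (\<exists>U \<Phi> r'. hol_coord p U \<Phi> \<and> local_defining_fun (\<Phi> ` (M \<inter> U)) 0 r' \<and> \<not> convenient r'))"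
proof -
  let ?c3 = "\<exists>\<gamma> \<in> Gamma_reg p. inf_tangent r \<gamma>"
  let ?c4 = "\<exists>\<gamma> \<in> Gamma p. inf_tangent r \<gamma>"
  let ?c5 = "\<exists>U \<Phi> r'. hol_coord p U \<Phi> \<and> local_defining_fun (\<Phi> ` (M \<inter> U)) 0 r' \<and> \<not> convenient r'"
  obtain U \<Phi> r' where can: "hol_coord p U \<Phi>" "local_defining_fun (\<Phi> ` (M \<inter> U)) 0 r'" "N_nondegenerate r'"
    using assms(4) unfolding has_N_canonical_coord_def by blast
  \<comment> \<open>Contrapositive form: (1), (2) and (4) each force the canonical defining function
    not to be convenient.\<close>
  have finite: "Delta1 r p \<noteq> \<infinity> \<and> Delta1_reg r p \<noteq> \<infinity> \<and> \<not> ?c4" if conv: "convenient r'"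
  proof -
    obtain K where K: "\<forall>\<gamma>\<in>Gamma p. \<exists>A::nat. 0 < A \<and> enat A \<le> vanish_ord (\<lambda>t. \<gamma> t - p) \<and>
      vanish_ord (r \<circ> \<gamma>) \<le> enat (K * A)"
      using Gamma_type_bound[OF assms(2,3) can conv] ..
    have "\<not> inf_tangent r \<gamma>" if "\<gamma> \<in> Gamma p" for \<gamma>
      using K that inf_tangent_vanish_ord[of r \<gamma>] by fastforce
    moreover have "Delta1_reg r p \<noteq> \<infinity>"
      using Delta1_reg_le[OF K] infinity_ileE by metis
    ultimately show ?thesis using Delta1_le[OF K] by auto
  qed
  have 53: ?c3 if ?c5
  proof -
    from that obtain U \<Phi> r' where "hol_coord p U \<Phi>" "local_defining_fun (\<Phi> ` (M \<inter> U)) 0 r'" "\<not> convenient r'"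
      by blast
    then show ?thesis by (rule nonconvenient_imp_tangent[OF assms(2,3)])
  qed
  \<comment> \<open>On a regular curve the denominator is 1, so a single tangent curve makes both
    suprema infinite.\<close>
  have tangent: "Delta1 r p = \<infinity> \<and> Delta1_reg r p = \<infinity> \<and> ?c4" if ?c3
  proof -
    from that obtain \<gamma> where \<gamma>: "\<gamma> \<in> Gamma_reg p" "inf_tangent r \<gamma>" by blast
    then have \<Gamma>: "\<gamma> \<in> Gamma p" "vanish_ord (\<lambda>t. \<gamma> t - p) = 1" by (auto simp: Gamma_reg_def)
    note inf = inf_tangent_vanish_ord[OF \<gamma>(2)]
    have "vanish_ord (r \<circ> \<gamma>) \<le> Delta1_reg r p" unfolding Delta1_reg_def by (rule SUP_upper[OF \<gamma>(1)])
    moreover have "ereal_of_enat (vanish_ord (r \<circ> \<gamma>)) / ereal_of_enat (vanish_ord (\<lambda>t. \<gamma> t - p)) \<le> Delta1 r p"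
      unfolding Delta1_def by (rule SUP_upper[OF \<Gamma>(1)])
    ultimately show ?thesis using inf \<Gamma> \<gamma>(2) by (auto simp: one_enat_def)
  qed
  \<comment> \<open>Closes the cycle: when its defining function is not convenient, the canonical
    coordinate itself witnesses (5).\<close>
  have "\<not> convenient r' \<Longrightarrow> ?c5" using can by blast
  then show ?thesis using finite 53 tangent by blast
qed

end
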